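(* For every integer $d\ge4$ and every real $c$ with $0\le c\le2-\sqrt3$, the family $$\{A_1(d,t),\ldots,A_d(d,t)\}\cup\{E_{d,c}^{(r)}(t):2\le r\le d-2\}$$ is compatible. Moreover, the number $2-\sqrt3$ is the largest $c\ge0$ for which this family is compatible for every $d\ge4$.
   Context: For $1\le i\le d$, the refined Eulerian polynomial is $A_i(d,t)=\sum_{\pi\in S_d,\ \pi_d=d+1-i}t^{\operatorname{des}(\pi)}$, where $\operatorname{des}(\pi)$ is the number of descents of $\pi$ (indices $k<d$ with $\pi_k>\pi_{k+1}$). For real $c$, $E_{d,c}^{(r)}(t)=A_{r+1}(d,t)-cA_r(d,t)$. A finite family of real polynomials is compatible if every nonnegative linear combination of its members has only real zeros (the identically zero combination being disregarded). *)

theory Defs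
  imports Complex_Main "HOL-Computational_Algebra.Polynomial" "HOL-Combinatorics.Permutations"
begin

definition des :: "nat \<Rightarrow> (nat \<Rightarrow> nat) \<Rightarrow> nat" where
  "des d \<pi> = card {k. 1 \<le> k \<and> k < d \<and> \<pi> k > \<pi> (k + 1)}"

(* A permutation of {1..d} is a function fixing every point outside {1..d}, as in the library
   predicate permutes.  Only indices 1 \<le> i \<le> d are meaningful. *)
definition refined_Eulerian :: "nat \<Rightarrow> nat \<Rightarrow> real poly" where
  "refined_Eulerian d i = (\<Sum>\<pi> | \<pi> permutes {1..d} \<and> \<pi> d = d + 1 - i. monom 1 (des d \<pi>))"

definition E_poly :: "nat \<Rightarrow> real \<Rightarrow> nat \<Rightarrow> real poly" where
  "E_poly d c r = refined_Eulerian d (r + 1) - smult c (refined_Eulerian d r)"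

definition only_real_zeros :: "real poly \<Rightarrow> bool" where
  "only_real_zeros p \<longleftrightarrow> (\<forall>z::complex. poly (map_poly complex_of_real p) z = 0 \<longrightarrow> z \<in> \<real>)"

(* Families are rendered as sets: repeated members do not change the nonnegative combinations. *)
definition compatible :: "real poly set \<Rightarrow> bool" where
  "compatible F \<longleftrightarrow> finite F \<and>
     (\<forall>w :: real poly \<Rightarrow> real. (\<forall>p\<in>F. w p \<ge> 0) \<longrightarrow>
        (\<Sum>p\<in>F. smult (w p) p) \<noteq> 0 \<longrightarrow> only_real_zeros (\<Sum>p\<in>F. smult (w p) p))"

definition Eulerian_family :: "nat \<Rightarrow> real \<Rightarrow> real poly set" where
  "Eulerian_family d c = refined_Eulerian d ` {1..d} \<union> E_poly d c ` {2..d - 2}"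

end

(* A permutation of {1..d+1} arises from one of {1..d} by appending a last value e and raising the values
   \<ge> e, so A_{i+1}(d+1) = A_i(d+1) - (1 - t) A_i(d), and A_{i+1}(d+1) = (1 - t) t A_i(d)' + d t A_i(d).
   For fixed t < 0 this recurrence preserves two properties of the sequence A_1(d,t), ..., A_d(d,t): at most
   one sign change, and strict log-concavity. The latter propagates inwards from the two ends, where it is the
   Turan inequality B_{n-1} B_{n+1} < B_n^2 for the Eulerian polynomials B_n = A_1(n+1).

   Compatibility is certified by the signs of the members of the family at the d - 1 zeros of t A_1(d):
   a polynomial p of degree \<le> d - 1 whose values there agree in sign with the derivative of t A_1(d) cannot
   have a positive quadratic factor, because Lagrange interpolation makes the residues of the cofactor sum to 0.
   At a zero t of A_1(d), A_{i+1}(d,t) is -(1 - t) times the i-th partial sum of A_1(d-1,t), ..., A_{d-1}(d-1,t),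
   and by log-concavity the smallest ratio of consecutive partial sums is governed by the last two terms.
   It is at least 2 - sqrt 3 because ((1 - t) B_{d-3})^2 \<le> 3 B_{d-2}^2, which is the Laguerre inequality for
   B_{d-3} in the coordinate (1 + t) / (1 - t) plus the square (B_{d-2} - (1 + t) B_{d-3})^2.

   For d = 4 and c > 2 - sqrt 3 a combination of A_1, A_2 and E^{(2)} is a quadratic of negative discriminant. *)

theory Submission
  imports Defs "HOL-Computational_Algebra.Fundamental_Theorem_Algebra"
begin

section \<open>Sign conditions forcing real zeros\<close>

lemma map_poly_of_real_add:
  "map_poly complex_of_real (p + q) = map_poly complex_of_real p + map_poly complex_of_real q"
  by (intro poly_eqI) (simp add: coeff_map_poly)

lemma map_poly_of_real_mult:
  "map_poly complex_of_real (p * q) = map_poly complex_of_real p * map_poly complex_of_real q"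
  by (intro poly_eqI) (simp add: coeff_map_poly coeff_mult)

lemma poly_map_poly_of_real:
  "poly (map_poly complex_of_real p) (of_real x) = of_real (poly p x)"
  by (induction p) (simp_all add: map_poly_pCons)

text \<open>The sum is the coefficient at degree \<open>card G - 1\<close> of the Lagrange
  interpolant of \<open>f\<close> on \<open>G\<close>. The interpolant is \<open>f\<close> itself,
  whose degree is too small for that coefficient to be nonzero.\<close>

lemma lagrange_sum:
  fixes f :: "real poly"
  assumes fin: "finite G" and deg: "degree f + 2 \<le> card G"
  shows "(\<Sum>x\<in>G. poly f x / (\<Prod>y\<in>G - {x}. x - y)) = 0"
proof -
  define L where "L x = (\<Prod>y\<in>G - {x}. [:- y, 1:])" for x :: real
  define W where "W x = (\<Prod>y\<in>G - {x}. x - y)" for x :: real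
  define S where "S = (\<Sum>x\<in>G. smult (poly f x / W x) (L x))"
  have degL: "degree (L x) = card G - 1" if "x \<in> G" for x
    using that fin by (simp add: L_def degree_prod_eq_sum_degree card_Diff_singleton)
  have leadL: "coeff (L x) (card G - 1) = 1" if "x \<in> G" for x
    using lead_coeff_prod[of "\<lambda>y. [:- y, 1:]" "G - {x}"] degL[OF that] by (simp add: L_def)
  have W0: "W x \<noteq> 0" for x
    using fin by (simp add: W_def prod_zero_iff)
  have pL: "poly (L x) z = (if z = x then W x else 0)" if "x \<in> G" "z \<in> G" for x z
    using that fin by (auto simp: L_def W_def poly_prod prod_zero_iff)
  have S_eq: "poly S z = poly f z" if "z \<in> G" for z
  proof -
    have "poly S z = (\<Sum>x\<in>G. poly f x / W x * (if z = x then W x else 0))"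
      unfolding S_def poly_sum by (intro sum.cong refl) (simp add: pL that)
    also have "\<dots> = (\<Sum>x\<in>G. if z = x then poly f x else 0)"
      by (intro sum.cong refl) (use W0 in auto)
    also have "\<dots> = poly f z"
      using that fin by simp
    finally show ?thesis .
  qed
  have "degree S \<le> card G - 1"
    unfolding S_def by (intro degree_sum_le fin order_trans[OF degree_smult_le]) (simp add: degL)
  then have "degree (S - f) \<le> card G - 1"
    using deg by (intro degree_diff_le) auto
  then have dS: "degree (S - f) < card G"
    using deg by linarith
  \<comment> \<open>The difference vanishes on all of \<open>G\<close> but has degree below
    \<open>card G\<close>.\<close>
  have "S - f = 0"
  proof (rule ccontr)
    assume nz: "S - f \<noteq> 0"
    have "card G \<le> card {z. poly (S - f) z = 0}"
      by (rule card_mono[OF poly_roots_finite[OF nz]]) (use S_eq in auto)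
    then show False
      using dS card_poly_roots_bound[OF nz] by linarith
  qed
  then have "coeff S (card G - 1) = coeff f (card G - 1)"
    by simp
  also have "\<dots> = 0"
    using deg by (intro coeff_eq_0) linarith
  finally have "(\<Sum>x\<in>G. poly f x / W x * coeff (L x) (card G - 1)) = 0"
    by (simp add: S_def coeff_sum)
  then show ?thesis
    by (simp add: leadL W_def cong: sum.cong del: One_nat_def)
qed

text \<open>Dividing by the positive factor \<open>q\<close> keeps the signs, so every term of the
  Lagrange sum of the cofactor is nonnegative. The sum is 0, hence the cofactor vanishes on
  \<open>G\<close>, which has more points than its degree allows. The factor \<open>q\<close> will
  be a conjugate pair of nonreal zeros or the square of a linear factor.\<close>

lemma no_positive_quadratic_factor:
  fixes p q :: "real poly"
  assumes fin: "finite G" and deg: "degree p \<le> card G"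
    and sgn: "\<And>x. x \<in> G \<Longrightarrow> 0 \<le> poly p x * (\<Prod>y\<in>G - {x}. x - y)"
    and q: "degree q = 2" "\<And>x. x \<in> G \<Longrightarrow> 0 < poly q x"
    and dvd: "q dvd p"
  shows "p = 0"
proof (rule ccontr)
  assume "p \<noteq> 0"
  obtain f where f: "p = q * f"
    using dvd by (elim dvdE)
  have "f \<noteq> 0" "q \<noteq> 0"
    using f \<open>p \<noteq> 0\<close> by auto
  then have dp: "degree p = degree f + 2"
    using q(1) f by (simp add: degree_mult_eq)
  define W where "W x = (\<Prod>y\<in>G - {x}. x - y)" for x :: real
  have "(\<Sum>x\<in>G. poly f x / W x) = 0"
    unfolding W_def by (rule lagrange_sum) (use fin dp deg in auto)
  moreover have nn: "0 \<le> poly f x / W x" if "x \<in> G" for x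
  proof -
    have "0 \<le> poly q x * (poly f x * W x)"
      using sgn[OF that] by (simp add: f W_def mult.assoc)
    then have "0 \<le> poly f x * W x"
      using q(2)[OF that] by (simp add: zero_le_mult_iff)
    then show ?thesis
      by (simp add: zero_le_divide_iff zero_le_mult_iff)
  qed
  ultimately have "\<forall>x\<in>G. poly f x / W x = 0"
    using sum_nonneg_eq_0_iff[OF fin] by (metis (no_types, lifting))
  moreover have "W x \<noteq> 0" for x
    using fin by (simp add: W_def prod_zero_iff)
  ultimately have "G \<subseteq> {x. poly f x = 0}"
    by auto
  then have "card G \<le> degree f"
    using card_mono[OF poly_roots_finite[OF \<open>f \<noteq> 0\<close>]] card_poly_roots_bound[OF \<open>f \<noteq> 0\<close>]
    by (meson order_trans)
  then show False
    using dp deg by linarith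
qed

text \<open>The remainder modulo the quadratic is a real polynomial of degree at most 1 that
  vanishes at a nonreal point, so it is 0.\<close>

lemma nonreal_root_quadratic_dvd:
  fixes p :: "real poly"
  assumes z: "poly (map_poly complex_of_real p) z = 0" and im: "Im z \<noteq> 0"
  shows "[:(cmod z)\<^sup>2, - 2 * Re z, 1:] dvd p"
proof -
  define q where "q = [:(cmod z)\<^sup>2, - 2 * Re z, 1:]"
  define a b where "a = p div q" and "b = p mod q"
  have p: "p = q * a + b"
    by (simp add: a_def b_def)
  have "poly (map_poly complex_of_real q) z = 0"
    unfolding q_def cmod_power2
    by (simp add: complex_eq_iff power2_eq_square map_poly_pCons algebra_simps)
  then have bz: "poly (map_poly complex_of_real b) z = 0"
    using z by (simp add: p map_poly_of_real_add map_poly_of_real_mult poly_mult)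
  have "degree b < 2"
    using degree_mod_less[of q p] by (auto simp: b_def q_def)
  then obtain \<beta> \<gamma> where b: "b = [:\<beta>, \<gamma>:]"
    by (cases b rule: pCons_cases) (metis One_nat_def degree_pCons_eq_if less_2_cases_iff degree_eq_zeroE nat.inject pCons_0_0 zero_neq_one)
  have "of_real \<beta> + z * of_real \<gamma> = 0"
    using bz by (simp add: b map_poly_pCons)
  then have "b = 0"
    using im by (auto simp: b complex_eq_iff)
  then show ?thesis
    using p unfolding q_def by (metis add.right_neutral dvd_triv_left)
qed

lemma only_real_zeros_of_signs:
  fixes p :: "real poly"
  assumes fin: "finite G" and deg: "degree p \<le> card G"
    and sgn: "\<And>x. x \<in> G \<Longrightarrow> 0 \<le> poly p x * (\<Prod>y\<in>G - {x}. x - y)"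
    and "p \<noteq> 0"
  shows "only_real_zeros p"
  unfolding only_real_zeros_def
proof (intro allI impI)
  fix z assume z: "poly (map_poly complex_of_real p) z = 0"
  show "z \<in> \<real>"
  proof (rule ccontr)
    assume "z \<notin> \<real>"
    then have im: "Im z \<noteq> 0"
      by (simp add: complex_is_Real_iff)
    have "0 < poly [:(cmod z)\<^sup>2, - 2 * Re z, 1:] x" for x
    proof -
      have "poly [:(cmod z)\<^sup>2, - 2 * Re z, 1:] x = (x - Re z)\<^sup>2 + (Im z)\<^sup>2"
        unfolding cmod_power2 by (simp add: power2_eq_square algebra_simps)
      also have "\<dots> > 0"
        using im by (simp add: add_nonneg_pos)
      finally show ?thesis .
    qed
    then show False
      using no_positive_quadratic_factor[OF fin deg sgn _ _ nonreal_root_quadratic_dvd[OF z im]] \<open>p \<noteq> 0\<close>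
      by simp
  qed
qed

lemma complex_root_exists:
  fixes p :: "real poly"
  assumes "0 < degree p"
  obtains z where "poly (map_poly complex_of_real p) z = 0"
proof -
  have "\<not> constant (poly (map_poly complex_of_real p))"
    using assms by (simp add: constant_degree degree_map_poly)
  then show ?thesis
    using fundamental_theorem_of_algebra that by blast
qed

text \<open>Induction on the degree, splitting off one linear factor. The product over the set of
  zeros counts each zero once, which is where squarefreeness enters.\<close>

lemma real_rooted_squarefree_prod:
  fixes p :: "real poly"
  assumes "p \<noteq> 0" "only_real_zeros p" "\<And>r. \<not> [:- r, 1:]\<^sup>2 dvd p"
  shows "p = smult (lead_coeff p) (\<Prod>r | poly p r = 0. [:- r, 1:])"
  using assms
proof (induction "degree p" arbitrary: p)
  case 0
  then obtain a where "p = [:a:]" "a \<noteq> 0"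
    using degree_eq_zeroE by (metis pCons_0_0)
  then show ?case
    by simp
next
  case (Suc n)
  obtain z where z: "poly (map_poly complex_of_real p) z = 0"
    using complex_root_exists Suc.hyps(2) by (metis zero_less_Suc)
  then obtain r where r: "z = of_real r"
    using Suc.prems(2) by (auto simp: only_real_zeros_def elim: Reals_cases)
  then have "poly p r = 0"
    using z by (simp add: r poly_map_poly_of_real)
  then obtain f where f: "p = [:- r, 1:] * f"
    by (auto simp: poly_eq_0_iff_dvd)
  have "f \<noteq> 0"
    using f Suc.prems by auto
  have "degree p = Suc (degree f)"
    using \<open>f \<noteq> 0\<close> unfolding f by (subst degree_mult_eq) auto
  then have "n = degree f"
    using Suc.hyps(2) by simp
  moreover have "only_real_zeros f"
    using Suc.prems(2) unfolding only_real_zeros_def f by (simp add: map_poly_of_real_mult del: mult_pCons_left)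
  moreover have "\<not> [:- s, 1:]\<^sup>2 dvd f" for s
    using Suc.prems(3)[of s] by (metis dvd_mult f)
  ultimately have IH: "f = smult (lead_coeff f) (\<Prod>r | poly f r = 0. [:- r, 1:])"
    using Suc.hyps(1) \<open>f \<noteq> 0\<close> by blast
  have fr: "poly f r \<noteq> 0"
  proof
    assume "poly f r = 0"
    then have "[:- r, 1:]\<^sup>2 dvd p"
      unfolding f power2_eq_square poly_eq_0_iff_dvd by (rule mult_dvd_mono[OF dvd_refl])
    then show False
      using Suc.prems(3) by blast
  qed
  have roots: "{s. poly p s = 0} = insert r {s. poly f s = 0}"
    by (auto simp: f simp del: mult_pCons_left)
  have "lead_coeff p = lead_coeff f"
    unfolding f lead_coeff_mult by simp
  moreover have "(\<Prod>r | poly p r = 0. [:- r, 1:]) = [:- r, 1:] * (\<Prod>r | poly f r = 0. [:- r, 1:])"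
    unfolding roots using fr poly_roots_finite[OF \<open>f \<noteq> 0\<close>] by (subst prod.insert) auto
  ultimately show ?case
    using f IH by (metis mult_smult_right)
qed

text \<open>Strict signs also exclude double zeros: no point of \<open>G\<close> is a zero of
  \<open>p\<close>, so a square factor \<open>[:- r, 1:]\<^sup>2\<close> would be positive on
  \<open>G\<close>.\<close>

lemma squarefree_real_rooted_of_signs:
  fixes p :: "real poly"
  assumes fin: "finite G" and deg: "degree p \<le> card G"
    and sgn: "\<And>x. x \<in> G \<Longrightarrow> 0 < poly p x * (\<Prod>y\<in>G - {x}. x - y)"
    and "p \<noteq> 0"
  shows "p = smult (lead_coeff p) (\<Prod>r | poly p r = 0. [:- r, 1:])"
proof (rule real_rooted_squarefree_prod)
  show "only_real_zeros p"
    by (rule only_real_zeros_of_signs[OF fin deg]) (use sgn \<open>p \<noteq> 0\<close> in \<open>auto intro: less_imp_le\<close>)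
  show "\<not> [:- r, 1:]\<^sup>2 dvd p" for r
  proof
    assume dvd: "[:- r, 1:]\<^sup>2 dvd p"
    have "0 < poly ([:- r, 1:]\<^sup>2) x" if "x \<in> G" for x
    proof -
      have "poly ([:- r, 1:]\<^sup>2) x \<noteq> 0"
        using dvd sgn[OF that] by (auto simp: dvd_def)
      then show ?thesis
        by (auto simp: poly_power zero_less_power2)
    qed
    moreover have "degree ([:- r, 1:]\<^sup>2) = 2"
      by (simp add: degree_power_eq)
    ultimately show False
      using no_positive_quadratic_factor[OF fin deg _ _ _ dvd] sgn \<open>p \<noteq> 0\<close> by (meson less_imp_le)
  qed
qed fact


section \<open>Recurrences for refined Eulerian polynomials\<close>

text \<open>Composing with \<open>insert_value d e\<close> appends the last value \<open>e\<close> and raises the values \<open>\<ge> e\<close>.\<close>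
definition insert_value :: "nat \<Rightarrow> nat \<Rightarrow> nat \<Rightarrow> nat" where
  "insert_value d e x = (if x < e then x else if x \<le> d then x + 1 else if x = d + 1 then e else x)"

lemma insert_value_permutes:
  assumes "1 \<le> e" "e \<le> d + 1"
  shows "insert_value d e permutes {1..d + 1}"
proof (rule bij_imp_permutes)
  have "inj_on (insert_value d e) {1..d + 1}"
    using assms by (auto simp: inj_on_def insert_value_def split: if_splits)
  moreover have "insert_value d e ` {1..d + 1} \<subseteq> {1..d + 1}"
    using assms by (auto simp: insert_value_def)
  ultimately show "bij_betw (insert_value d e) {1..d + 1} {1..d + 1}"
    by (simp add: bij_betw_def endo_inj_surj)
qed (use assms in \<open>auto simp: insert_value_def\<close>)

text \<open>The inverse composes with the inverse of \<open>insert_value d e\<close>; the result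
  fixes \<open>d + 1\<close>, hence permutes \<open>{1..d}\<close>.\<close>

lemma bij_betw_insert_value:
  assumes e: "1 \<le> e" "e \<le> d + 1"
  shows "bij_betw (\<lambda>\<sigma>. insert_value d e \<circ> \<sigma>) {\<sigma>. \<sigma> permutes {1..d}}
           {\<pi>. \<pi> permutes {1..d + 1} \<and> \<pi> (d + 1) = e}"
proof -
  define \<kappa> where "\<kappa> = insert_value d e"
  have \<kappa>: "\<kappa> permutes {1..d + 1}"
    unfolding \<kappa>_def by (rule insert_value_permutes[OF e])
  have last: "\<kappa> (d + 1) = e"
    using e by (simp add: \<kappa>_def insert_value_def)
  show ?thesis
    unfolding \<kappa>_def[symmetric]
  proof (rule bij_betw_byWitness[where f' = "\<lambda>\<pi>. inv \<kappa> \<circ> \<pi>"])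
    show "\<forall>\<sigma>\<in>{\<sigma>. \<sigma> permutes {1..d}}. inv \<kappa> \<circ> (\<kappa> \<circ> \<sigma>) = \<sigma>"
      by (simp add: o_assoc permutes_inv_o[OF \<kappa>])
    show "\<forall>\<pi>\<in>{\<pi>. \<pi> permutes {1..d + 1} \<and> \<pi> (d + 1) = e}. \<kappa> \<circ> (inv \<kappa> \<circ> \<pi>) = \<pi>"
      by (simp add: o_assoc permutes_inv_o[OF \<kappa>])
    show "(\<lambda>\<sigma>. \<kappa> \<circ> \<sigma>) ` {\<sigma>. \<sigma> permutes {1..d}} \<subseteq> {\<pi>. \<pi> permutes {1..d + 1} \<and> \<pi> (d + 1) = e}"
    proof clarify
      fix \<sigma> assume \<sigma>: "\<sigma> permutes {1..d}"
      then have "\<sigma> permutes {1..d + 1}"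
        by (rule permutes_subset) auto
      moreover have "\<sigma> (d + 1) = d + 1"
        using \<sigma> by (simp add: permutes_not_in)
      ultimately show "\<kappa> \<circ> \<sigma> permutes {1..d + 1} \<and> (\<kappa> \<circ> \<sigma>) (d + 1) = e"
        using \<kappa> last by (simp add: permutes_compose)
    qed
    show "(\<lambda>\<pi>. inv \<kappa> \<circ> \<pi>) ` {\<pi>. \<pi> permutes {1..d + 1} \<and> \<pi> (d + 1) = e} \<subseteq> {\<sigma>. \<sigma> permutes {1..d}}"
    proof clarify
      fix \<pi> assume \<pi>: "\<pi> permutes {1..d + 1}" and "e = \<pi> (d + 1)"
      then have "inv \<kappa> (\<pi> (d + 1)) = d + 1"
        using last permutes_inverses(2)[OF \<kappa>] by metis
      moreover have "inv \<kappa> \<circ> \<pi> permutes {1..d + 1}"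
        using \<pi> \<kappa> by (intro permutes_compose permutes_inv)
      ultimately show "inv \<kappa> \<circ> \<pi> permutes {1..d}"
        by (elim permutes_superset) (auto simp: le_Suc_eq)
    qed
  qed
qed

text \<open>Raising values is strictly monotone on \<open>{1..d}\<close>, so the old descents are
  kept and only position \<open>d\<close> can become a new one.\<close>

lemma des_insert_value:
  assumes "1 \<le> d" "\<sigma> permutes {1..d}"
  shows "des (d + 1) (insert_value d e \<circ> \<sigma>) = des d \<sigma> + (if e \<le> \<sigma> d then 1 else 0)"
proof -
  have rng: "1 \<le> \<sigma> k \<and> \<sigma> k \<le> d" if "1 \<le> k" "k \<le> d" for k
    using permutes_in_image[OF assms(2), of k] that by auto
  have last: "\<sigma> (d + 1) = d + 1"
    using assms(2) by (simp add: permutes_not_in)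
  have mono: "insert_value d e (\<sigma> k) > insert_value d e (\<sigma> (k + 1)) \<longleftrightarrow> \<sigma> k > \<sigma> (k + 1)"
    if "1 \<le> k" "k < d" for k
    using rng[of k] rng[of "k + 1"] that by (auto simp: insert_value_def)
  have top: "insert_value d e (\<sigma> d) > insert_value d e (\<sigma> (d + 1)) \<longleftrightarrow> e \<le> \<sigma> d"
    using rng[of d] assms(1) last by (auto simp: insert_value_def)
  have "{k. 1 \<le> k \<and> k < d + 1 \<and> (insert_value d e \<circ> \<sigma>) k > (insert_value d e \<circ> \<sigma>) (k + 1)}
      = {k. 1 \<le> k \<and> k < d \<and> \<sigma> k > \<sigma> (k + 1)} \<union> (if e \<le> \<sigma> d then {d} else {})"
    using mono top assms(1) by (auto simp: less_Suc_eq split: if_splits)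
  moreover have "finite {k. 1 \<le> k \<and> k < d \<and> \<sigma> k > \<sigma> (k + 1)}"
    by (rule finite_subset[of _ "{..<d}"]) auto
  ultimately show ?thesis
    unfolding des_def by (simp add: card_insert_if)
qed

text \<open>The permutations of \<open>{1..d}\<close> are grouped by
  \<open>j = d + 1 - \<sigma> d\<close>. In these terms the condition
  \<open>e \<le> \<sigma> d\<close> for a new descent reads \<open>j < i\<close>.\<close>

lemma refined_Eulerian_rec:
  assumes "1 \<le> d" "1 \<le> i" "i \<le> d + 1"
  shows "refined_Eulerian (d + 1) i =
    (\<Sum>j=1..d. (if j < i then [:0, 1:] else 1) * refined_Eulerian d j)"
proof -
  define e where "e = d + 1 + 1 - i"
  have e: "1 \<le> e" "e \<le> d + 1"
    using assms by (auto simp: e_def)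
  define h :: "(nat \<Rightarrow> nat) \<Rightarrow> real poly" where
    "h \<sigma> = monom 1 (des (d + 1) (insert_value d e \<circ> \<sigma>))" for \<sigma>
  have rng: "1 \<le> \<sigma> d \<and> \<sigma> d \<le> d" if "\<sigma> permutes {1..d}" for \<sigma>
    using permutes_in_image[OF that, of d] assms(1) by auto
  have "refined_Eulerian (d + 1) i = (\<Sum>\<sigma> | \<sigma> permutes {1..d}. h \<sigma>)"
    unfolding refined_Eulerian_def e_def[symmetric] h_def
    by (rule sum.reindex_bij_betw[OF bij_betw_insert_value[OF e], symmetric])
  also have "\<dots> = (\<Sum>j=1..d. \<Sum>\<sigma>\<in>{\<sigma> \<in> {\<sigma>. \<sigma> permutes {1..d}}. d + 1 - \<sigma> d = j}. h \<sigma>)"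
  proof (rule sum.group[symmetric])
    show "(\<lambda>\<sigma>. d + 1 - \<sigma> d) ` {\<sigma>. \<sigma> permutes {1..d}} \<subseteq> {1..d}"
    proof clarify
      fix \<sigma> assume "\<sigma> permutes {1..d}"
      from rng[OF this] show "d + 1 - \<sigma> d \<in> {1..d}" by auto
    qed
  qed (simp_all add: finite_permutations)
  also have "\<dots> = (\<Sum>j=1..d. (if j < i then [:0, 1:] else 1) * refined_Eulerian d j)"
  proof (rule sum.cong[OF refl])
    fix j assume j: "j \<in> {1..d}"
    have "{\<sigma> \<in> {\<sigma>. \<sigma> permutes {1..d}}. d + 1 - \<sigma> d = j} = {\<sigma>. \<sigma> permutes {1..d} \<and> \<sigma> d = d + 1 - j}"
      using j rng by force
    moreover have "h \<sigma> = (if j < i then [:0, 1:] else 1) * monom 1 (des d \<sigma>)"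
      if "\<sigma> permutes {1..d}" "\<sigma> d = d + 1 - j" for \<sigma>
    proof -
      have "e \<le> \<sigma> d \<longleftrightarrow> j < i"
        using j assms that(2) by (auto simp: e_def)
      then show ?thesis
        unfolding h_def des_insert_value[OF assms(1) that(1)] by (simp add: monom_Suc)
    qed
    ultimately show "(\<Sum>\<sigma>\<in>{\<sigma> \<in> {\<sigma>. \<sigma> permutes {1..d}}. d + 1 - \<sigma> d = j}. h \<sigma>) =
        (if j < i then [:0, 1:] else 1) * refined_Eulerian d j"
      unfolding refined_Eulerian_def sum_distrib_left by (intro sum.cong) auto
  qed
  finally show ?thesis .
qed

lemma refined_Eulerian_Suc:
  assumes "1 \<le> i" "i \<le> d"
  shows "refined_Eulerian (d + 1) (i + 1) =
    refined_Eulerian (d + 1) i - (1 - [:0, 1:]) * refined_Eulerian d i"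
proof -
  have d: "1 \<le> d" using assms by simp
  have "refined_Eulerian (d + 1) i - refined_Eulerian (d + 1) (i + 1) =
      (\<Sum>j=1..d. (if j < i then [:0, 1:] else 1) * refined_Eulerian d j
        - (if j < i + 1 then [:0, 1:] else 1) * refined_Eulerian d j)"
    unfolding sum_subtractf using assms d
      refined_Eulerian_rec[of d i] refined_Eulerian_rec[of d "i + 1"]
    by (simp del: mult_pCons_left)
  also have "\<dots> = (\<Sum>j=1..d. if j = i then (1 - [:0, 1:]) * refined_Eulerian d j else 0)"
    by (intro sum.cong refl) (auto simp: ring_distribs simp del: mult_pCons_left)
  also have "\<dots> = (1 - [:0, 1:]) * refined_Eulerian d i"
    using assms by (simp del: mult_pCons_left)
  finally show ?thesis
    by (simp add: algebra_simps)
qed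

lemma refined_Eulerian_last:
  assumes "1 \<le> d"
  shows "refined_Eulerian (d + 1) (d + 1) = [:0, 1:] * refined_Eulerian (d + 1) 1"
  using assms by (subst (1 2) refined_Eulerian_rec) (auto simp: sum_distrib_left intro!: sum.cong)

lemma refined_Eulerian_1_1: "refined_Eulerian 1 1 = 1"
proof -
  have "{\<pi>. \<pi> permutes {Suc 0} \<and> \<pi> (Suc 0) = Suc 0} = {id}"
    by auto
  then show ?thesis
    by (simp add: refined_Eulerian_def des_def)
qed

text \<open>Induction on \<open>d\<close>. The defect \<open>C j\<close> between the two sides does
  not depend on \<open>j\<close>, by the difference recurrence and the induction hypothesis.
  Comparing the last index with the first gives \<open>C 1 = X * C 1\<close>, so the defect is
  0.\<close>

lemma refined_Eulerian_pderiv: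
  assumes "1 \<le> i" "i \<le> d"
  shows "refined_Eulerian (d + 1) (i + 1) =
    (1 - [:0, 1:]) * [:0, 1:] * pderiv (refined_Eulerian d i) + of_nat d * [:0, 1:] * refined_Eulerian d i"
  using assms
proof (induction d arbitrary: i)
  case 0
  then show ?case by simp
next
  case (Suc d)
  define X :: "real poly" where "X = [:0, 1:]"
  have dX: "pderiv X = 1"
    by (simp add: X_def pderiv_pCons)
  show ?case
  proof (cases "d = 0")
    case True
    then have "i = 1" using Suc.prems by simp
    moreover have "refined_Eulerian (1 + 1) (1 + 1) = X"
      using refined_Eulerian_last[of 1] refined_Eulerian_rec[of 1 1]
      by (simp add: X_def refined_Eulerian_1_1[simplified])
    ultimately show ?thesis
      using True by (simp add: refined_Eulerian_1_1[simplified] X_def)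
  next
    case False
    define A where "A j = refined_Eulerian (d + 1) j" for j
    define Y where "Y j = (1 - X) * X * pderiv (A j) + of_nat (d + 1) * X * A j" for j
    define C where "C j = refined_Eulerian (d + 2) (j + 1) - Y j" for j
    have A_last: "A (d + 1) = X * A 1"
      using refined_Eulerian_last[of d] False by (simp add: A_def X_def del: mult_pCons_left)
    have step: "C (j + 1) = C j" if j: "1 \<le> j" "j \<le> d" for j
    proof -
      define a where "a = refined_Eulerian d j"
      have A1: "A (j + 1) = A j - (1 - X) * a"
        unfolding A_def a_def X_def by (rule refined_Eulerian_Suc[OF j])
      have IH: "A (j + 1) = (1 - X) * X * pderiv a + of_nat d * X * a"
        unfolding A_def a_def X_def by (rule Suc.IH[OF j])
      have "refined_Eulerian (d + 2) (j + 1 + 1) = refined_Eulerian (d + 2) (j + 1) - (1 - X) * A (j + 1)"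
        using refined_Eulerian_Suc[of "j + 1" "d + 1"] j unfolding A_def X_def by simp
      then have "C (j + 1) - C j = Y j - Y (j + 1) - (1 - X) * A (j + 1)"
        unfolding C_def by simp
      also have "Y j - Y (j + 1) = (1 - X) * ((1 - X) * X * pderiv a + of_nat d * X * a)"
      proof -
        have dA: "pderiv (A (j + 1)) = pderiv (A j) - ((1 - X) * pderiv a - a)"
          unfolding A1 pderiv_diff pderiv_mult dX by simp
        show ?thesis
          unfolding Y_def dA unfolding A1 by (simp add: algebra_simps)
      qed
      also have "\<dots> - (1 - X) * A (j + 1) = 0"
        unfolding IH by simp
      finally show ?thesis by simp
    qed
    have const: "C j = C 1" if "1 \<le> j" "j \<le> d + 1" for j
      using that by (induction j rule: dec_induct) (use step in auto)
    have l1: "refined_Eulerian (d + 2) (d + 1 + 1) = X * refined_Eulerian (d + 2) 1"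
      using refined_Eulerian_last[of "d + 1"] by (simp add: X_def del: mult_pCons_left)
    have l2: "refined_Eulerian (d + 2) (1 + 1) = refined_Eulerian (d + 2) 1 - (1 - X) * A 1"
      using refined_Eulerian_Suc[of 1 "d + 1"] unfolding A_def X_def by simp
    have "C (d + 1) = X * C 1"
      unfolding C_def Y_def A_last l1 l2 by (simp add: pderiv_mult dX algebra_simps del: mult_pCons_left)
    then have "(1 - X) * C 1 = 0"
      using const[of "d + 1"] by (simp add: algebra_simps)
    moreover have "1 - X \<noteq> 0"
      by (simp add: X_def one_pCons)
    ultimately have "C i = 0"
      using const[of i] Suc.prems by simp
    then show ?thesis
      by (simp add: C_def Y_def A_def X_def del: mult_pCons_left)
  qed
qed


section \<open>Laguerre and Turan inequalities\<close>

text \<open>How the Laguerre expression changes when a zero \<open>r\<close> is adjoined; this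
  drives the induction over the zeros in both inequalities below.\<close>

lemma product_Laguerre_step:
  fixes P :: "real poly" and r t :: real
  defines "Q \<equiv> [:- r, 1:] * P"
  shows "poly (pderiv Q) t ^ 2 - poly Q t * poly (pderiv (pderiv Q)) t =
    poly P t ^ 2 + (t - r) ^ 2 * (poly (pderiv P) t ^ 2 - poly P t * poly (pderiv (pderiv P)) t)"
    and "poly Q t = (t - r) * poly P t" "poly (pderiv Q) t = poly P t + (t - r) * poly (pderiv P) t"
proof -
  have d1: "pderiv Q = P + [:- r, 1:] * pderiv P"
    unfolding Q_def pderiv_mult by (simp add: pderiv_pCons del: mult_pCons_left)
  have d2: "pderiv (pderiv Q) = 2 * pderiv P + [:- r, 1:] * pderiv (pderiv P)"
    unfolding d1 pderiv_add pderiv_mult by (simp add: pderiv_pCons del: mult_pCons_left)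
  show Q: "poly Q t = (t - r) * poly P t"
    by (simp add: Q_def algebra_simps)
  show Q': "poly (pderiv Q) t = poly P t + (t - r) * poly (pderiv P) t"
    unfolding d1 by (simp add: algebra_simps)
  have Q'': "poly (pderiv (pderiv Q)) t = 2 * poly (pderiv P) t + (t - r) * poly (pderiv (pderiv P)) t"
    unfolding d2 by (simp add: algebra_simps)
  show "poly (pderiv Q) t ^ 2 - poly Q t * poly (pderiv (pderiv Q)) t =
    poly P t ^ 2 + (t - r) ^ 2 * (poly (pderiv P) t ^ 2 - poly P t * poly (pderiv (pderiv P)) t)"
    unfolding Q Q' Q'' by algebra
qed

text \<open>The Laguerre inequality for \<open>Q (- exp s)\<close> as a function of \<open>s\<close>.\<close>
lemma Laguerre_exp:
  fixes t :: real and R :: "real set"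
  assumes "finite R" "\<And>r. r \<in> R \<Longrightarrow> r < 0" "t < 0"
  defines "Q \<equiv> \<Prod>r\<in>R. [:- r, 1:]"
  shows "0 \<le> t\<^sup>2 * (poly (pderiv Q) t ^ 2 - poly Q t * poly (pderiv (pderiv Q)) t)
              - t * poly Q t * poly (pderiv Q) t"
  unfolding Q_def using assms(1,2)
proof (induction R)
  case empty
  then show ?case by simp
next
  case (insert r R)
  define P where "P = (\<Prod>r\<in>R. [:- r, 1:])"
  define p p' p'' where "p = poly P t" and "p' = poly (pderiv P) t" and "p'' = poly (pderiv (pderiv P)) t"
  have ins: "(\<Prod>r\<in>insert r R. [:- r, 1:]) = [:- r, 1:] * P"
    using insert.hyps by (simp add: P_def)
  have "0 \<le> t\<^sup>2 * (p'\<^sup>2 - p * p'') - t * p * p'"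
    using insert.IH insert.prems by (simp add: P_def p_def p'_def p''_def)
  \<comment> \<open>The new zero contributes exactly this term, nonnegative because \<open>r\<close>
    and \<open>t\<close> are both negative.\<close>
  moreover have "0 \<le> r * t * p\<^sup>2"
    using insert.prems[of r] assms(3) by (simp add: mult_nonpos_nonpos)
  ultimately have "0 \<le> (t - r)\<^sup>2 * (t\<^sup>2 * (p'\<^sup>2 - p * p'') - t * p * p') + r * t * p\<^sup>2"
    by simp
  also have "\<dots> = t\<^sup>2 * (p\<^sup>2 + (t - r)\<^sup>2 * (p'\<^sup>2 - p * p'')) - t * ((t - r) * p) * (p + (t - r) * p')"
    by algebra
  finally show ?case
    unfolding ins product_Laguerre_step(1) unfolding product_Laguerre_step(2,3) p_def p'_def p''_def .
qed

text \<open>The Laguerre inequality after the substitution \<open>x = (1 + t) / (1 - t)\<close>.\<close>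
lemma Laguerre_Moebius:
  fixes t :: real and R :: "real set"
  assumes "finite R"
  defines "Q \<equiv> \<Prod>r\<in>R. [:- r, 1:]"
  shows "0 \<le> real (card R) * poly Q t ^ 2 + 2 * (1 - t) * poly Q t * poly (pderiv Q) t
              + (1 - t)\<^sup>2 * (poly (pderiv Q) t ^ 2 - poly Q t * poly (pderiv (pderiv Q)) t)"
  unfolding Q_def using assms(1)
proof (induction R)
  case empty
  then show ?case by simp
next
  case (insert r R)
  define P where "P = (\<Prod>r\<in>R. [:- r, 1:])"
  define p p' p'' where "p = poly P t" and "p' = poly (pderiv P) t" and "p'' = poly (pderiv (pderiv P)) t"
  define m where "m = real (card R)"
  have ins: "(\<Prod>r\<in>insert r R. [:- r, 1:]) = [:- r, 1:] * P"
    using insert.hyps by (simp add: P_def)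
  have card: "real (card (insert r R)) = m + 1"
    using insert.hyps by (simp add: m_def)
  have "0 \<le> m * p\<^sup>2 + 2 * (1 - t) * p * p' + (1 - t)\<^sup>2 * (p'\<^sup>2 - p * p'')"
    using insert.IH by (simp add: P_def p_def p'_def p''_def m_def)
  \<comment> \<open>Here the new zero contributes the square \<open>((1 - r) * p)\<^sup>2\<close>,
    whatever the sign of \<open>r\<close>.\<close>
  then have "0 \<le> (t - r)\<^sup>2 * (m * p\<^sup>2 + 2 * (1 - t) * p * p' + (1 - t)\<^sup>2 * (p'\<^sup>2 - p * p'')) + ((1 - r) * p)\<^sup>2"
    by simp
  also have "\<dots> = (m + 1) * ((t - r) * p)\<^sup>2 + 2 * (1 - t) * ((t - r) * p) * (p + (t - r) * p')
      + (1 - t)\<^sup>2 * (p\<^sup>2 + (t - r)\<^sup>2 * (p'\<^sup>2 - p * p''))"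
    by algebra
  finally show ?case
    unfolding ins card product_Laguerre_step(1) unfolding product_Laguerre_step(2,3) p_def p'_def p''_def .
qed

section \<open>Recurrences for the Eulerian polynomials B_n\<close>

abbreviation Eulerian_poly :: "nat \<Rightarrow> real poly" where
  "Eulerian_poly n \<equiv> refined_Eulerian (n + 1) 1"

lemma Eulerian_poly_0: "Eulerian_poly 0 = 1"
  using refined_Eulerian_1_1 by simp

text \<open>The difference recurrence and the derivative recurrence both express A_2(n + 2);
  equating them eliminates it.\<close>

lemma Eulerian_poly_Suc:
  "Eulerian_poly (n + 1) = (1 + of_nat n * [:0, 1:]) * Eulerian_poly n
      + (1 - [:0, 1:]) * [:0, 1:] * pderiv (Eulerian_poly n)"
proof -
  have "refined_Eulerian (n + 1 + 1) (1 + 1) = Eulerian_poly (n + 1) - (1 - [:0, 1:]) * Eulerian_poly n"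
    by (rule refined_Eulerian_Suc) auto
  moreover have "refined_Eulerian (n + 1 + 1) (1 + 1) =
    (1 - [:0, 1:]) * [:0, 1:] * pderiv (Eulerian_poly n) + of_nat (n + 1) * [:0, 1:] * Eulerian_poly n"
    by (rule refined_Eulerian_pderiv) auto
  ultimately show ?thesis
    unfolding of_nat_add of_nat_1 by algebra
qed

lemma Eulerian_poly_1: "Eulerian_poly 1 = 1"
  using Eulerian_poly_Suc[of 0] Eulerian_poly_0 by simp

lemma poly_Eulerian_poly_Suc:
  "poly (Eulerian_poly (n + 1)) t =
    (1 + real n * t) * poly (Eulerian_poly n) t + t * (1 - t) * poly (pderiv (Eulerian_poly n)) t"
  unfolding Eulerian_poly_Suc
  by (simp add: of_nat_poly algebra_simps del: mult_pCons_left)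

lemma poly_Eulerian_poly_Suc_Suc:
  "poly (Eulerian_poly (n + 2)) t =
    (1 + (real n + 1) * t) * poly (Eulerian_poly (n + 1)) t
    + t * (1 - t) * (real n * poly (Eulerian_poly n) t + (1 + real n * t) * poly (pderiv (Eulerian_poly n)) t
      + (1 - 2 * t) * poly (pderiv (Eulerian_poly n)) t + t * (1 - t) * poly (pderiv (pderiv (Eulerian_poly n))) t)"
proof -
  have "poly (pderiv (Eulerian_poly (n + 1))) t =
     real n * poly (Eulerian_poly n) t + (1 + real n * t) * poly (pderiv (Eulerian_poly n)) t
      + (1 - 2 * t) * poly (pderiv (Eulerian_poly n)) t + t * (1 - t) * poly (pderiv (pderiv (Eulerian_poly n))) t"
    unfolding Eulerian_poly_Suc of_nat_poly
    by (simp add: pderiv_mult pderiv_add pderiv_diff pderiv_pCons algebra_simps del: mult_pCons_left)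
  then show ?thesis
    using poly_Eulerian_poly_Suc[of "n + 1" t] by simp
qed


section \<open>Degrees, zeros and factorization of the Eulerian polynomials\<close>

lemma poly_refined_Eulerian:
  "poly (refined_Eulerian d i) x = (\<Sum>\<pi> | \<pi> permutes {1..d} \<and> \<pi> d = d + 1 - i. x ^ des d \<pi>)"
  by (simp add: refined_Eulerian_def poly_sum poly_monom)

lemma degree_refined_Eulerian_le: "degree (refined_Eulerian d i) \<le> d - 1"
  unfolding refined_Eulerian_def
proof (rule degree_sum_le)
  show "finite {\<pi>. \<pi> permutes {1..d} \<and> \<pi> d = d + 1 - i}"
    by (rule finite_subset[OF _ finite_permutations[of "{1..d}"]]) auto
  fix \<pi>
  have "des d \<pi> \<le> card {1..<d}"
    unfolding des_def by (rule card_mono) auto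
  then show "degree (monom (1::real) (des d \<pi>)) \<le> d - 1"
    using degree_monom_le[of "1::real" "des d \<pi>"] by simp
qed

text \<open>All terms are nonnegative and the identity permutation contributes 1.\<close>

lemma Eulerian_poly_pos:
  assumes "0 \<le> x"
  shows "0 < poly (Eulerian_poly n) x"
proof -
  let ?S = "{\<pi>. \<pi> permutes {1..n + 1} \<and> \<pi> (n + 1) = n + 1 + 1 - 1}"
  have "finite ?S"
    by (rule finite_subset[OF _ finite_permutations[of "{1..n + 1}"]]) auto
  moreover have "id \<in> ?S" "des (n + 1) id = 0"
    by (simp_all add: permutes_id des_def)
  ultimately have "x ^ 0 \<le> poly (Eulerian_poly n) x"
    unfolding poly_refined_Eulerian using assms
    by (metis (no_types, lifting) member_le_sum zero_le_power)
  then show ?thesis by simp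
qed

lemma poly_Eulerian_poly_0: "poly (Eulerian_poly n) 0 = 1"
proof (induction n)
  case 0
  show ?case by (subst Eulerian_poly_0) simp
next
  case (Suc n)
  then show ?case
    using poly_Eulerian_poly_Suc[of n 0] by simp
qed

lemma coeff_Eulerian_poly_Suc:
  "coeff (Eulerian_poly (n + 1)) (k + 1) =
    (real k + 2) * coeff (Eulerian_poly n) (k + 1) + (real n - real k) * coeff (Eulerian_poly n) k"
proof -
  have eq: "Eulerian_poly (n + 1) = Eulerian_poly n + pCons 0 (smult (real n) (Eulerian_poly n))
     + pCons 0 (pderiv (Eulerian_poly n)) - pCons 0 (pCons 0 (pderiv (Eulerian_poly n)))"
    unfolding Eulerian_poly_Suc of_nat_poly by (simp add: algebra_simps)
  show ?thesis
    by (subst eq, cases k) (simp_all add: coeff_pderiv algebra_simps)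
qed

text \<open>The range \<open>n \<le> k\<close> covers the leading coefficient and all vanishing ones
  at once, which is what the coefficient recurrence needs for induction.\<close>

lemma Eulerian_poly_monic: "coeff (Eulerian_poly (n + 1)) k = (if k = n then 1 else 0)" if "n \<le> k"
  using that
proof (induction n arbitrary: k)
  case 0
  from Eulerian_poly_1 show ?case
    by (simp add: one_pCons coeff_pCons split: nat.split)
next
  case (Suc n)
  then obtain j where k: "k = j + 1" "n \<le> j"
    by (cases k) auto
  show ?case
    using coeff_Eulerian_poly_Suc[of "n + 1" j] Suc.IH[of j] Suc.IH[of "j + 1"] k by auto
qed

lemma degree_Eulerian_poly: "degree (Eulerian_poly (n + 1)) = n"
proof (rule antisym)
  show "degree (Eulerian_poly (n + 1)) \<le> n"
    by (rule degree_le) (use Eulerian_poly_monic in auto)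
  show "n \<le> degree (Eulerian_poly (n + 1))"
    by (rule le_degree) (simp add: Eulerian_poly_monic[of n n, simplified])
qed

lemma lead_coeff_Eulerian_poly: "lead_coeff (Eulerian_poly (n + 1)) = 1"
  unfolding degree_Eulerian_poly by (simp add: Eulerian_poly_monic[of n n, simplified])

lemma poly_pderiv_prod_root:
  fixes R :: "real set"
  assumes "finite R" "r \<in> R"
  shows "poly (pderiv (\<Prod>y\<in>R. [:- y, 1:])) r = (\<Prod>y\<in>R - {r}. r - y)"
proof -
  have "(\<Prod>y\<in>R. [:- y, 1:]) = [:- r, 1:] * (\<Prod>y\<in>R - {r}. [:- y, 1:])"
    by (rule prod.remove[OF assms])
  then show ?thesis
    using product_Laguerre_step(3)[of r "\<Prod>y\<in>R - {r}. [:- y, 1:]" r] by (simp add: poly_prod)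
qed

definition Eulerian_zeros :: "nat \<Rightarrow> real set" where
  "Eulerian_zeros n = {r. poly (Eulerian_poly n) r = 0}"

lemma Eulerian_zeros_neg: "r \<in> Eulerian_zeros n \<Longrightarrow> r < 0"
  using Eulerian_poly_pos[of r n] by (force simp: Eulerian_zeros_def)

lemma finite_Eulerian_zeros: "finite (Eulerian_zeros n)"
  unfolding Eulerian_zeros_def
  by (rule poly_roots_finite) (use poly_Eulerian_poly_0[of n] in auto)

text \<open>Induction by the strict sign criterion, tested at 0 and at the zeros of the previous
  polynomial B. At such a zero the recurrence leaves only the term with the derivative of B, and
  this derivative is the product of differences to the other zeros, so the tested quantity is a
  positive multiple of a square.\<close>

lemma Eulerian_poly_Suc_factorization:
  "Eulerian_poly (n + 1) = (\<Prod>r\<in>Eulerian_zeros (n + 1). [:- r, 1:])"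
proof (induction n)
  case 0
  from Eulerian_poly_1 show ?case
    by (simp add: Eulerian_zeros_def)
next
  case (Suc n)
  define R where "R = Eulerian_zeros (n + 1)"
  define B where "B = Eulerian_poly (n + 1)"
  have R: "finite R" "\<And>r. r \<in> R \<Longrightarrow> r < 0"
    using finite_Eulerian_zeros Eulerian_zeros_neg by (auto simp: R_def)
  have B: "B = (\<Prod>r\<in>R. [:- r, 1:])"
    using Suc.IH by (simp add: B_def R_def)
  have "degree B = card R"
    unfolding B using R(1) by (subst degree_prod_eq_sum_degree) auto
  then have cardR: "card R = n"
    using degree_Eulerian_poly[of n] by (simp add: B_def)
  have "0 \<notin> R"
    using R(2) by blast
  then have cardG: "card (insert 0 R) = n + 1"
    using R(1) cardR by simp
  have "Eulerian_poly (n + 1 + 1) =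
    smult (lead_coeff (Eulerian_poly (n + 1 + 1))) (\<Prod>r | poly (Eulerian_poly (n + 1 + 1)) r = 0. [:- r, 1:])"
  proof (rule squarefree_real_rooted_of_signs)
    show "finite (insert 0 R)" using R by simp
    show "degree (Eulerian_poly (n + 1 + 1)) \<le> card (insert 0 R)"
      unfolding degree_Eulerian_poly cardG by simp
    show "Eulerian_poly (n + 1 + 1) \<noteq> 0"
      using poly_Eulerian_poly_0[of "n + 1 + 1"] by auto
    fix x assume "x \<in> insert 0 R"
    then consider "x = 0" | "x \<in> R" "x < 0"
      using R(2) by blast
    then show "0 < poly (Eulerian_poly (n + 1 + 1)) x * (\<Prod>y\<in>insert 0 R - {x}. x - y)"
    proof cases
      case 1
      have "0 < (\<Prod>y\<in>insert 0 R - {0}. 0 - y)"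
        by (rule prod_pos) (use R(2) in auto)
      then show ?thesis
        unfolding 1 poly_Eulerian_poly_0 by simp
    next
      case 2
      define D where "D = (\<Prod>y\<in>R - {x}. x - y)"
      have "D \<noteq> 0"
        using R(1) by (simp add: D_def prod_zero_iff)
      have "insert 0 R - {x} = insert 0 (R - {x})"
        using 2 by auto
      then have "(\<Prod>y\<in>insert 0 R - {x}. x - y) = x * D"
        using R(1) \<open>0 \<notin> R\<close> by (simp add: D_def)
      moreover have "poly B x = 0"
        using 2 by (simp add: R_def Eulerian_zeros_def B_def)
      moreover have "poly (pderiv B) x = D"
        unfolding B D_def by (rule poly_pderiv_prod_root[OF R(1) 2(1)])
      ultimately have "poly (Eulerian_poly (n + 1 + 1)) x * (\<Prod>y\<in>insert 0 R - {x}. x - y) = (1 - x) * (x * D)\<^sup>2"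
        unfolding poly_Eulerian_poly_Suc[of "n + 1"] B_def[symmetric]
        by (simp add: power2_eq_square algebra_simps)
      also have "\<dots> > 0"
        using 2 \<open>D \<noteq> 0\<close> by simp
      finally show ?thesis .
    qed
  qed
  then show ?case
    using lead_coeff_Eulerian_poly[of "n + 1"] by (simp add: Eulerian_zeros_def)
qed

lemma Eulerian_poly_factorization: "Eulerian_poly n = (\<Prod>r\<in>Eulerian_zeros n. [:- r, 1:])"
proof (cases n)
  case 0
  then show ?thesis
    using Eulerian_poly_0 by (simp add: Eulerian_zeros_def)
next
  case (Suc m)
  then show ?thesis
    using Eulerian_poly_Suc_factorization[of m] by simp
qed

lemma card_Eulerian_zeros: "card (Eulerian_zeros (n + 1)) = n"
proof -
  have "degree (\<Prod>r\<in>Eulerian_zeros (n + 1). [:- r, 1:]) = card (Eulerian_zeros (n + 1))"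
    using finite_Eulerian_zeros[of "n + 1"] by (subst degree_prod_eq_sum_degree) auto
  then show ?thesis
    unfolding Eulerian_poly_factorization[symmetric] degree_Eulerian_poly by simp
qed

lemma Eulerian_poly_simple_zero:
  assumes "poly (Eulerian_poly n) t = 0"
  shows "poly (pderiv (Eulerian_poly n)) t = (\<Prod>y\<in>Eulerian_zeros n - {t}. t - y)"
    and "poly (pderiv (Eulerian_poly n)) t \<noteq> 0"
proof -
  have "t \<in> Eulerian_zeros n"
    using assms by (simp add: Eulerian_zeros_def)
  then show 1: "poly (pderiv (Eulerian_poly n)) t = (\<Prod>y\<in>Eulerian_zeros n - {t}. t - y)"
    using poly_pderiv_prod_root[OF finite_Eulerian_zeros]
    unfolding Eulerian_poly_factorization[symmetric] by blast
  show "poly (pderiv (Eulerian_poly n)) t \<noteq> 0"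
    unfolding 1 by (simp add: prod_zero_iff finite_Eulerian_zeros)
qed

text \<open>The recurrences turn the defect into \<open>(1 - t)\<^sup>2\<close> times the expression
  \<open>M\<close> of \<open>Laguerre_exp\<close>, plus the nonnegative term
  \<open>- (n + 1) * t * Q\<^sup>2\<close>. Strictness comes from the second term, or from the
  simplicity of the zero when \<open>Q = 0\<close>.\<close>

lemma Eulerian_Turan:
  assumes "t < 0"
  shows "poly (Eulerian_poly n) t * poly (Eulerian_poly (n + 2)) t < poly (Eulerian_poly (n + 1)) t ^ 2"
proof -
  define Q Q' Q'' where "Q = poly (Eulerian_poly n) t" and "Q' = poly (pderiv (Eulerian_poly n)) t"
    and "Q'' = poly (pderiv (pderiv (Eulerian_poly n))) t"
  define M where "M = t\<^sup>2 * (Q'\<^sup>2 - Q * Q'') - t * Q * Q'"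
  have id: "poly (Eulerian_poly (n + 1)) t ^ 2 - Q * poly (Eulerian_poly (n + 2)) t
      = (1 - t)\<^sup>2 * M - (real n + 1) * t * Q\<^sup>2"
    unfolding M_def poly_Eulerian_poly_Suc_Suc poly_Eulerian_poly_Suc Q_def[symmetric] Q'_def[symmetric] Q''_def[symmetric]
    by algebra
  have "0 \<le> M"
    using Laguerre_exp[OF finite_Eulerian_zeros[of n] Eulerian_zeros_neg assms]
    unfolding Eulerian_poly_factorization[symmetric] by (simp add: M_def Q_def Q'_def Q''_def)
  have "0 < (1 - t)\<^sup>2 * M - (real n + 1) * t * Q\<^sup>2"
  proof (cases "Q = 0")
    case True
    then have "Q' \<noteq> 0"
      using Eulerian_poly_simple_zero(2)[of n t] by (simp add: Q_def Q'_def)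
    then show ?thesis
      using True assms by (simp add: M_def)
  next
    case False
    then have "(real n + 1) * t * Q\<^sup>2 < 0"
      using assms by (intro mult_neg_pos mult_pos_neg) auto
    moreover have "0 \<le> (1 - t)\<^sup>2 * M"
      using \<open>0 \<le> M\<close> by simp
    ultimately show ?thesis by linarith
  qed
  then show ?thesis
    using id by (simp add: Q_def)
qed

lemma Eulerian_ratio_at_zero:
  assumes "t < 0" "1 \<le> n" "poly (Eulerian_poly (n + 2)) t = 0"
  shows "((1 - t) * poly (Eulerian_poly n) t)\<^sup>2 \<le> 3 * (poly (Eulerian_poly (n + 1)) t)\<^sup>2"
proof -
  define Q Q' Q'' where "Q = poly (Eulerian_poly n) t" and "Q' = poly (pderiv (Eulerian_poly n)) t"
    and "Q'' = poly (pderiv (pderiv (Eulerian_poly n))) t"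
  define b where "b = (1 + real n * t) * Q + t * (1 - t) * Q'"
  have b: "poly (Eulerian_poly (n + 1)) t = b"
    unfolding b_def Q_def Q'_def by (rule poly_Eulerian_poly_Suc)
  have zero: "(1 + (real n + 1) * t) * b
    + t * (1 - t) * (real n * Q + (1 + real n * t) * Q' + (1 - 2 * t) * Q' + t * (1 - t) * Q'') = 0"
    using assms(3) poly_Eulerian_poly_Suc_Suc[of n t] b by (simp add: Q_def Q'_def Q''_def)
  \<comment> \<open>B_n has degree \<open>n - 1\<close> for positive \<open>n\<close>.\<close>
  have card: "real (card (Eulerian_zeros n)) = real n - 1"
    using card_Eulerian_zeros[of "n - 1"] assms(2) by (simp add: of_nat_diff)
  have "0 \<le> (real n - 1) * Q\<^sup>2 + 2 * (1 - t) * Q * Q' + (1 - t)\<^sup>2 * (Q'\<^sup>2 - Q * Q'')"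
    using Laguerre_Moebius[OF finite_Eulerian_zeros[of n], of t]
    unfolding Eulerian_poly_factorization[symmetric] card by (simp add: Q_def Q'_def Q''_def)
  then have "0 \<le> 2 * t\<^sup>2 * ((real n - 1) * Q\<^sup>2 + 2 * (1 - t) * Q * Q' + (1 - t)\<^sup>2 * (Q'\<^sup>2 - Q * Q''))"
    by simp
  \<comment> \<open>The vanishing of B_{n+2} eliminates the second derivative and the definition of
    \<open>b\<close> eliminates the first.\<close>
  also have "\<dots> = 3 * b\<^sup>2 - ((1 - t) * Q)\<^sup>2 - (b - (1 + t) * Q)\<^sup>2"
    using zero b_def by algebra
  finally show ?thesis
    unfolding b Q_def[symmetric] using zero_le_power2[of "b - (1 + t) * Q"] by linarith
qed


section \<open>Log-concavity\<close>

text \<open>No positivity is demanded of the entries, so the property is invariant under negation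
  and reversal.\<close>

definition strictly_log_concave :: "nat \<Rightarrow> (nat \<Rightarrow> real) \<Rightarrow> bool" where
  "strictly_log_concave d v \<longleftrightarrow> (\<forall>i. 1 \<le> i \<longrightarrow> i + 2 \<le> d \<longrightarrow> v i * v (i + 2) < (v (i + 1))\<^sup>2)"

definition positive_then_negative :: "nat \<Rightarrow> (nat \<Rightarrow> real) \<Rightarrow> bool" where
  "positive_then_negative d v \<longleftrightarrow> (\<forall>i j. 1 \<le> i \<longrightarrow> i < j \<longrightarrow> j \<le> d \<longrightarrow> v i < 0 \<longrightarrow> v j \<le> 0)"

lemma positive_then_negative_split:
  assumes "positive_then_negative d v"
  obtains k where "k \<le> d" "\<And>i. 1 \<le> i \<Longrightarrow> i \<le> k \<Longrightarrow> 0 \<le> v i" "\<And>i. k < i \<Longrightarrow> i \<le> d \<Longrightarrow> v i \<le> 0"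
proof (cases "\<exists>i. 1 \<le> i \<and> i \<le> d \<and> v i < 0")
  case True
  define m where "m = (LEAST i. 1 \<le> i \<and> i \<le> d \<and> v i < 0)"
  have m: "1 \<le> m" "m \<le> d" "v m < 0"
    using LeastI_ex[OF True] by (auto simp: m_def)
  have "0 \<le> v i" if "1 \<le> i" "i < m" for i
    using not_less_Least[of i "\<lambda>i. 1 \<le> i \<and> i \<le> d \<and> v i < 0"] that m by (force simp: m_def)
  moreover have "v i \<le> 0" if "m \<le> i" "i \<le> d" for i
    using assms m that by (cases "i = m") (auto simp: positive_then_negative_def)
  ultimately show ?thesis
    using m by (intro that[of "m - 1"]) auto
next
  case False
  then show ?thesis
    by (intro that[of d]) force+
qed

text \<open>With \<open>W i = u i * v (i + 1) - u (i + 1) * v i\<close> one has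
  \<open>v (i + 1) * W i - v i * W (i + 1) = u (i + 1) * ((v (i + 1))\<^sup>2 - v i * v (i + 2))\<close>,
  and \<open>h * W i\<close> is the log-concavity defect of \<open>u\<close>. The identity propagates positivity of \<open>W\<close> forward
  or backward according to the signs of \<open>u\<close> and \<open>v\<close>, from the two ends and from the sign change of \<open>u\<close>.\<close>
lemma strictly_log_concave_step_aux:
  fixes u v :: "nat \<Rightarrow> real"
  assumes d: "2 \<le> d" and h: "0 < h"
    and rec: "\<And>i. 1 \<le> i \<Longrightarrow> i \<le> d \<Longrightarrow> u (i + 1) = u i - h * v i"
    and ends: "0 \<le> u 1" "u (d + 1) \<le> 0"
    and lc: "strictly_log_concave d v" and pn: "positive_then_negative d v"
    and first: "u 1 * u 3 < (u 2)\<^sup>2" and last: "u (d - 1) * u (d + 1) < (u d)\<^sup>2"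
  shows "strictly_log_concave (d + 1) u \<and> positive_then_negative (d + 1) u"
proof -
  obtain k where k: "k \<le> d" and vpos: "\<And>i. 1 \<le> i \<Longrightarrow> i \<le> k \<Longrightarrow> 0 \<le> v i"
    and vneg: "\<And>i. k < i \<Longrightarrow> i \<le> d \<Longrightarrow> v i \<le> 0"
    using positive_then_negative_split[OF pn] by blast
  define W where "W i = u i * v (i + 1) - u (i + 1) * v i" for i
  define T where "T i = (v (i + 1))\<^sup>2 - v i * v (i + 2)" for i
  have T: "0 < T i" if "1 \<le> i" "i + 2 \<le> d" for i
    using lc that by (simp add: strictly_log_concave_def T_def)
  have hW: "(u (i + 1))\<^sup>2 - u i * u (i + 2) = h * W i" if "1 \<le> i" "i + 1 \<le> d" for i
  proof -
    have "u (i + 1) = u i - h * v i" "u (i + 2) = u (i + 1) - h * v (i + 1)"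
      using rec[of i] rec[of "i + 1"] that by simp_all
    then show ?thesis
      unfolding W_def by algebra
  qed
  have WT: "v (i + 1) * W i - v i * W (i + 1) = u (i + 1) * T i" if "1 \<le> i" "i + 2 \<le> d" for i
  proof -
    have "u (i + 1) = u i - h * v i" "u (i + 2) = u (i + 1) - h * v (i + 1)"
      using rec[of i] rec[of "i + 1"] that by simp_all
    moreover have W1: "W (i + 1) = u (i + 1) * v (i + 2) - u (i + 2) * v (i + 1)"
      by (simp add: W_def)
    ultimately show ?thesis
      unfolding W1 unfolding W_def T_def by algebra
  qed
  have W_iff: "0 < W i \<longleftrightarrow> u i * u (i + 2) < (u (i + 1))\<^sup>2" if "1 \<le> i" "i + 1 \<le> d" for i
    using hW[OF that] h zero_less_mult_iff[of h "W i"] by linarith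
  have W1: "0 < W 1"
    using W_iff[of 1] first d by (simp add: numeral_2_eq_2 numeral_3_eq_3)
  have Wd: "0 < W (d - 1)"
    using W_iff[of "d - 1"] last d by (simp add: numeral_2_eq_2 Suc_diff_Suc)
  have down: "u (i + 1) \<le> u i" if "1 \<le> i" "i \<le> k" for i
    using rec[of i] vpos[of i] that k h by simp
  have up: "u i \<le> u (i + 1)" if "k < i" "i \<le> d" for i
    using rec[of i] vneg[of i] that h by (simp add: mult_nonneg_nonpos)
  have dec: "u j \<le> u i" if "i \<le> j" "1 \<le> i" "j \<le> k + 1" for i j
    using that
  proof (induction j rule: dec_induct)
    case (step n)
    then show ?case using down[of n] by simp
  qed simp
  have inc: "u i \<le> u j" if "i \<le> j" "k < i" "j \<le> d + 1" for i j
    using that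
  proof (induction j rule: dec_induct)
    case (step n)
    then show ?case using up[of n] by simp
  qed simp
  \<comment> \<open>Two final zeros would give \<open>v d = 0\<close> and thus
    \<open>W (d - 1) = 0\<close>. This makes the weak sign at the end strict in the next
    step.\<close>
  have ud: "\<not> (u d = 0 \<and> u (d + 1) = 0)"
  proof
    assume "u d = 0 \<and> u (d + 1) = 0"
    then have "W (d - 1) = 0"
      using rec[of d] d h by (simp add: W_def)
    then show False using Wd by simp
  qed
  have N: "u i < 0" if "k < i" "i \<le> d" for i
  proof -
    have "u i \<le> u d" "u d \<le> u (d + 1)"
      using inc[of i d] inc[of d "d + 1"] that by auto
    then show ?thesis
      using ends(2) ud by linarith
  qed
  have uk: "u (k + 1) \<le> 0"
    using N[of "k + 1"] ends(2) k by (cases "k = d") auto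
  \<comment> \<open>Backward propagation inside the block where \<open>v\<close> is nonnegative, as
    long as \<open>u\<close> is nonnegative; the descent starts at the sign change of
    \<open>u\<close>.\<close>
  have Bk: "0 < W i" if "1 \<le> i" "i + 1 \<le> k" "0 \<le> u (i + 1)" for i
    using that
  proof (induction "k - i" arbitrary: i rule: less_induct)
    case less
    note i = less.prems
    have mono: "u (i + 1) \<le> u i" "u (i + 2) \<le> u (i + 1)"
      using down[of i] down[of "i + 1"] i by simp_all
    show ?case
    proof (cases "u (i + 2) \<le> 0")
      case False
      then have "i + 1 \<noteq> k" using uk by auto
      then have i2: "i + 2 \<le> k" using i by simp
      have "0 < W (i + 1)"
        using less.hyps[of "i + 1"] i2 i False by simp
      moreover have "0 < u (i + 1)" "0 < T i"
        using False mono(2) T[of i] i2 k i by auto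
      ultimately have "0 < v i * W (i + 1) + u (i + 1) * T i"
        using vpos[of i] i by (simp add: add_nonneg_pos)
      then have "0 < v (i + 1) * W i"
        using WT[of i] i2 k i by simp
      then show ?thesis
        using vpos[of "i + 1"] i by (simp add: zero_less_mult_iff)
    next
      case True
      have ik: "1 \<le> i" "i + 1 \<le> d" using i k by auto
      \<comment> \<open>At the sign change the product on the left is at most 0, so only
        \<open>u (i + 1) = 0\<close> is delicate. Then neither neighbour may vanish: that would
        produce a zero of \<open>v\<close> between entries of equal weak sign, against
        \<open>T\<close>, or a contradiction at an end of a block.\<close>
      have "u i * u (i + 2) < (u (i + 1))\<^sup>2"
      proof (cases "u (i + 1) = 0")
        case False
        have "u i * u (i + 2) \<le> 0"
          using True i mono by (intro mult_nonneg_nonpos) auto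
        moreover have "0 < (u (i + 1))\<^sup>2" using False by simp
        ultimately show ?thesis by linarith
      next
        case zero: True
        have "u (i + 2) \<noteq> 0"
        proof
          assume z: "u (i + 2) = 0"
          then have v0: "v (i + 1) = 0"
            using rec[of "i + 1"] zero h ik by simp
          consider "i + 2 \<le> k" | "i + 1 = k" "k < d" | "i + 1 = d"
            using i k by linarith
          then show False
          proof cases
            case 1
            then show False
              using T[of i] v0 vpos[of i] vpos[of "i + 2"] i k by (simp add: T_def mult_less_0_iff)
          next
            case 2
            then show False using N[of "i + 2"] z by simp
          next
            case 3
            have "i + 2 = d + 1" using 3 by simp
            then show False using ud zero z 3 by metis
          qed
        qed
        moreover have "u i \<noteq> 0"
        proof
          assume z: "u i = 0"
          then have v0: "v i = 0"
            using rec[of i] zero h ik by simp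
          show False
          proof (cases "i = 1")
            case True
            then show False using W1 z zero by (simp add: W_def)
          next
            case False
            then have "1 \<le> i - 1" "i - 1 \<le> k" using i by simp_all
            then show False
              using T[of "i - 1"] v0 vpos[of "i - 1"] vpos[of "i + 1"] i k
              by (simp add: T_def mult_less_0_iff)
          qed
        qed
        ultimately have "u i * u (i + 2) < 0"
          using True zero mono by (simp add: mult_pos_neg)
        then show ?thesis using zero by simp
      qed
      then show ?thesis using W_iff[OF ik] by simp
    qed
  qed
  \<comment> \<open>Forward propagation from \<open>W 1\<close> in the same block, where
    \<open>u (i + 1)\<close> is at most 0; the index at which \<open>u\<close> turns negative is
    handled directly.\<close>
  have Fw: "0 < W i" if "1 \<le> i" "i \<le> k" "i + 1 \<le> d" "u (i + 1) \<le> 0" for i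
    using that
  proof (induction i rule: dec_induct)
    case base
    show ?case by (rule W1)
  next
    case (step i)
    have i: "1 \<le> i" "i + 1 \<le> k" "i + 2 \<le> d" "u (i + 2) \<le> 0"
      using step.hyps step.prems by simp_all
    have "0 < W (i + 1)"
    proof (cases "u (i + 2) = 0")
      case True
      then have "i + 2 \<le> k" using N[of "i + 2"] i by force
      then show ?thesis using Bk[of "i + 1"] True by simp
    next
      case False
      then have neg: "u (i + 2) < 0" using i by simp
      show ?thesis
      proof (cases "0 < u (i + 1)")
        case True
        have "u (i + 3) \<le> 0"
        proof (cases "i + 2 \<le> k")
          case True
          then show ?thesis using down[of "i + 2"] i by (simp add: numeral_3_eq_3)
        next
          case False
          then show ?thesis using inc[of "i + 3" "d + 1"] i ends(2) by simp
        qed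
        then have "u (i + 1) * u (i + 3) \<le> 0"
          using True by (simp add: mult_nonneg_nonpos)
        moreover have "0 < (u (i + 2))\<^sup>2" using neg by simp
        ultimately have "u (i + 1) * u (i + 3) < (u (i + 2))\<^sup>2" by linarith
        then show ?thesis
          using W_iff[of "i + 1"] i by (simp add: numeral_2_eq_2 numeral_3_eq_3)
      next
        case False
        then have "0 < W i" using step.IH i by simp
        have "0 < v (i + 1) * W i - u (i + 1) * T i"
        proof (cases "u (i + 1) = 0")
          case True
          then have "v (i + 1) > 0"
            using rec[of "i + 1"] neg h i by (simp add: zero_less_mult_iff)
          then show ?thesis using True \<open>0 < W i\<close> by simp
        next
          case F: False
          have "u (i + 1) * T i < 0"
            using F False T[of i] i by (simp add: mult_neg_pos)
          moreover have "0 \<le> v (i + 1) * W i"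
            using \<open>0 < W i\<close> vpos[of "i + 1"] i by simp
          ultimately show ?thesis by linarith
        qed
        then have "0 < v i * W (i + 1)"
          using WT[of i] i by simp
        then show ?thesis
          using vpos[of i] i by (simp add: zero_less_mult_iff)
      qed
    qed
    then show ?case by simp
  qed
  \<comment> \<open>Backward propagation from \<open>W (d - 1)\<close> where \<open>v\<close> is
    nonpositive and \<open>u\<close> is negative.\<close>
  have neg: "0 < W i" if "k < i" "i \<le> d - 1" for i
    using that(2,1)
  proof (induction i rule: inc_induct)
    case base
    show ?case by (rule Wd)
  next
    case (step i)
    have i: "1 \<le> i" "i + 2 \<le> d" using step by auto
    have "v i * W (i + 1) \<le> 0"
      using step.IH step.prems vneg[of i] i by (simp add: mult_nonpos_nonneg)
    moreover have "u (i + 1) * T i < 0"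
      using N[of "i + 1"] T[of i] i step.prems by (simp add: mult_neg_pos)
    ultimately have "v (i + 1) * W i < 0"
      using WT[of i] i by linarith
    then show ?case
      using vneg[of "i + 1"] i step.prems by (simp add: mult_less_0_iff)
  qed
  have "0 < W i" if "1 \<le> i" "i + 1 \<le> d" for i
  proof (cases "k < i")
    case True
    then show ?thesis using neg that by simp
  next
    case False
    show ?thesis
    proof (cases "u (i + 1) \<le> 0")
      case True
      then show ?thesis using Fw False that by simp
    next
      case F: False
      then have "i + 1 \<le> k" using N[of "i + 1"] False that by force
      then show ?thesis using Bk F that by simp
    qed
  qed
  then have "strictly_log_concave (d + 1) u"
    using W_iff by (simp add: strictly_log_concave_def)
  moreover have "positive_then_negative (d + 1) u"
    unfolding positive_then_negative_def
  proof (intro allI impI)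
    fix i j assume ij: "1 \<le> i" "i < j" "j \<le> d + 1" "u i < 0"
    show "u j \<le> 0"
    proof (cases "k < j")
      case True
      then show ?thesis using inc[of j "d + 1"] ends(2) ij by simp
    next
      case False
      then show ?thesis using dec[of i j] ij by simp
    qed
  qed
  ultimately show ?thesis ..
qed

lemma strictly_log_concave_uminus: "strictly_log_concave d (\<lambda>i. - v i) = strictly_log_concave d v"
  by (simp add: strictly_log_concave_def)

lemma strictly_log_concave_rev:
  assumes "strictly_log_concave d (\<lambda>i. v (d + 1 - i))"
  shows "strictly_log_concave d v"
  unfolding strictly_log_concave_def
proof (intro allI impI)
  fix i assume i: "1 \<le> i" "i + 2 \<le> d"
  define j where "j = d + 1 - (i + 2)"
  have "d + 1 - j = i + 2" "d + 1 - (j + 1) = i + 1" "d + 1 - (j + 2) = i" "1 \<le> j" "j + 2 \<le> d"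
    using i by (auto simp: j_def)
  then show "v i * v (i + 2) < (v (i + 1))\<^sup>2"
    using assms unfolding strictly_log_concave_def by (metis mult.commute)
qed

lemma strictly_log_concave_step:
  fixes u v :: "nat \<Rightarrow> real"
  assumes d: "2 \<le> d" and h: "0 < h"
    and rec: "\<And>i. 1 \<le> i \<Longrightarrow> i \<le> d \<Longrightarrow> u (i + 1) = u i - h * v i"
    and ends: "(0 \<le> u 1 \<and> u (d + 1) \<le> 0) \<or> (u 1 \<le> 0 \<and> 0 \<le> u (d + 1))"
    and lc: "strictly_log_concave d v" and pn: "positive_then_negative d v"
    and first: "u 1 * u 3 < (u 2)\<^sup>2" and last: "u (d - 1) * u (d + 1) < (u d)\<^sup>2"
  shows "strictly_log_concave (d + 1) u \<and>
    (positive_then_negative (d + 1) u \<or> positive_then_negative (d + 1) (\<lambda>i. - u i))"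
  using ends
proof
  assume "0 \<le> u 1 \<and> u (d + 1) \<le> 0"
  then show ?thesis
    using strictly_log_concave_step_aux[OF d h rec _ _ lc pn first last] by blast
next
  assume e: "u 1 \<le> 0 \<and> 0 \<le> u (d + 1)"
  \<comment> \<open>Reversing both sequences and negating \<open>v\<close> preserves the recurrence
    and the sign pattern of \<open>v\<close>, and exchanges the signs at the two ends of
    \<open>u\<close>.\<close>
  define u' v' where "u' i = u (d + 2 - i)" and "v' i = - v (d + 1 - i)" for i
  have "strictly_log_concave (d + 1) u' \<and> positive_then_negative (d + 1) u'"
  proof (rule strictly_log_concave_step_aux[where v = v', OF d h])
    fix i assume i: "1 \<le> i" "i \<le> d"
    have "u (d + 1 - i + 1) = u (d + 1 - i) - h * v (d + 1 - i)"
      by (rule rec) (use i in auto)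
    moreover have "d + 1 - i + 1 = d + 2 - i" "d + 2 - (i + 1) = d + 1 - i"
      using i by auto
    ultimately show "u' (i + 1) = u' i - h * v' i"
      by (simp add: u'_def v'_def)
  next
    show "0 \<le> u' 1" "u' (d + 1) \<le> 0"
      using e by (simp_all add: u'_def)
  next
    have "strictly_log_concave d (\<lambda>i. v' (d + 1 - i))"
      unfolding strictly_log_concave_def
    proof (intro allI impI)
      fix i assume i: "1 \<le> i" "i + 2 \<le> d"
      then have "v' (d + 1 - i) = - v i" "v' (d + 1 - (i + 1)) = - v (i + 1)" "v' (d + 1 - (i + 2)) = - v (i + 2)"
        by (auto simp: v'_def)
      then show "v' (d + 1 - i) * v' (d + 1 - (i + 2)) < (v' (d + 1 - (i + 1)))\<^sup>2"
        using lc i by (simp add: strictly_log_concave_def)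
    qed
    then show "strictly_log_concave d v'"
      by (rule strictly_log_concave_rev)
  next
    show "positive_then_negative d v'"
      unfolding positive_then_negative_def
    proof (intro allI impI)
      fix i j assume ij: "1 \<le> i" "i < j" "j \<le> d" "v' i < 0"
      have "v (d + 1 - j) < 0 \<Longrightarrow> v (d + 1 - i) \<le> 0"
        using pn[unfolded positive_then_negative_def, rule_format, of "d + 1 - j" "d + 1 - i"] ij by auto
      then show "v' j \<le> 0"
        using ij(4) by (force simp: v'_def)
    qed
  next
    have "d + 2 - 3 = d - 1" by simp
    then show "u' 1 * u' 3 < (u' 2)\<^sup>2"
      using last by (simp add: u'_def mult.commute)
    have "d + 2 - (d - 1) = 3" "d + 2 - d = 2" "d + 2 - (d + 1) = 1" using d by auto
    then show "u' (d - 1) * u' (d + 1) < (u' d)\<^sup>2"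
      using first by (simp add: u'_def mult.commute)
  qed
  then have lc': "strictly_log_concave (d + 1) (\<lambda>i. u (d + 1 + 1 - i))" and pn': "positive_then_negative (d + 1) u'"
    by (simp_all add: u'_def[abs_def])
  have "positive_then_negative (d + 1) (\<lambda>i. - u i)"
    unfolding positive_then_negative_def
  proof (intro allI impI)
    fix i j assume ij: "1 \<le> i" "i < j" "j \<le> d + 1" "- u i < 0"
    have "u' (d + 2 - j) < 0 \<Longrightarrow> u' (d + 2 - i) \<le> 0"
      using pn'[unfolded positive_then_negative_def, rule_format, of "d + 2 - j" "d + 2 - i"] ij by auto
    moreover have "u' (d + 2 - j) = u j" "u' (d + 2 - i) = u i"
      using ij by (simp_all add: u'_def)
    ultimately show "- u j \<le> 0"
      using ij(4) by force
  qed
  then show ?thesis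
    using strictly_log_concave_rev[OF lc'] by simp
qed


section \<open>Log-concavity of the values A_1(d,t), ..., A_d(d,t) at negative t\<close>

lemma poly_refined_Eulerian_Suc:
  assumes "1 \<le> i" "i \<le> d"
  shows "poly (refined_Eulerian (d + 1) (i + 1)) t =
    poly (refined_Eulerian (d + 1) i) t - (1 - t) * poly (refined_Eulerian d i) t"
  unfolding refined_Eulerian_Suc[OF assms] by (simp add: algebra_simps)

lemma poly_refined_Eulerian_last:
  assumes "1 \<le> d"
  shows "poly (refined_Eulerian (d + 1) (d + 1)) t = t * poly (Eulerian_poly d) t"
  unfolding refined_Eulerian_last[OF assms] by simp

lemma refined_Eulerian_log_concave:
  fixes t :: real
  assumes t: "t < 0"
  defines "a \<equiv> \<lambda>d i. poly (refined_Eulerian d i) t"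
  shows "strictly_log_concave (n + 2) (a (n + 2)) \<and>
    (positive_then_negative (n + 2) (a (n + 2)) \<or> positive_then_negative (n + 2) (\<lambda>i. - a (n + 2) i))"
proof (induction n)
  case 0
  from Eulerian_poly_1 have "a 2 1 = 1"
    by (simp add: a_def numeral_2_eq_2)
  then have "positive_then_negative 2 (a 2)"
    unfolding positive_then_negative_def
  proof (intro allI impI)
    fix i j :: nat assume "1 \<le> i" "i < j" "j \<le> 2" "a 2 i < 0"
    then show "a 2 j \<le> 0"
      using \<open>a 2 1 = 1\<close> by (cases "i = 1") auto
  qed
  then show ?case
    unfolding add_0 by (simp add: strictly_log_concave_def)
next
  case (Suc n)
  define h where "h = 1 - t"
  define v u where "v = a (n + 2)" and "u = a (n + 3)"
  define p q r where "p = poly (Eulerian_poly n) t" and "q = poly (Eulerian_poly (n + 1)) t"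
    and "r = poly (Eulerian_poly (n + 2)) t"
  have h: "0 < h" using t by (simp add: h_def)
  have rec: "u (i + 1) = u i - h * v i" if "1 \<le> i" "i \<le> n + 2" for i
    using poly_refined_Eulerian_Suc[OF that, of t] by (simp add: u_def v_def a_def h_def eval_nat_numeral)
  have recv: "v (i + 1) = v i - h * a (n + 1) i" if "1 \<le> i" "i \<le> n + 1" for i
    using poly_refined_Eulerian_Suc[OF that, of t] by (simp add: v_def a_def h_def eval_nat_numeral)
  have u1: "u 1 = r" and v1: "v 1 = q" and a1: "a (n + 1) 1 = p"
    by (simp_all add: u_def v_def a_def p_def q_def r_def eval_nat_numeral)
  have ul: "u (n + 3) = t * r" and vl: "v (n + 2) = t * q"
    using poly_refined_Eulerian_last[of "n + 2" t] poly_refined_Eulerian_last[of "n + 1" t]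
    by (simp_all add: u_def v_def a_def q_def r_def eval_nat_numeral)
  have Turan: "p * r < q\<^sup>2"
    unfolding p_def q_def r_def by (rule Eulerian_Turan[OF t])
  then have pos: "0 < h\<^sup>2 * (q\<^sup>2 - p * r)"
    using h by simp
  \<comment> \<open>The defect at the left end is \<open>h\<^sup>2\<close> times the Turan defect;
    at the right end there is a further factor \<open>t\<^sup>2\<close>.\<close>
  have first: "u 1 * u 3 < (u 2)\<^sup>2"
  proof -
    have u2: "u 2 = r - h * q"
      using rec[of 1] u1 v1 by (simp add: numeral_2_eq_2)
    have v2: "v 2 = q - h * p"
      using recv[of 1] v1 a1 by (simp add: numeral_2_eq_2)
    have u3: "u 3 = u 2 - h * v 2"
      using rec[of 2] by simp
    have "(u 2)\<^sup>2 - u 1 * u 3 = h\<^sup>2 * (q\<^sup>2 - p * r)"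
      unfolding u3 u2 v2 u1 by algebra
    then show ?thesis using pos by linarith
  qed
  have last: "u (n + 1) * u (n + 3) < (u (n + 2))\<^sup>2"
  proof (cases "n = 0")
    case True
    then show ?thesis using first by (simp add: numeral_2_eq_2)
  next
    case False
    have al: "a (n + 1) (n + 1) = t * p"
      using poly_refined_Eulerian_last[of n t] False by (simp add: a_def p_def)
    have v1: "v (n + 1) = t * q + h * (t * p)"
      using recv[of "n + 1"] vl al by simp
    have u2: "u (n + 2) = t * r + h * (t * q)"
      using rec[of "n + 2"] vl ul by (simp add: numeral_3_eq_3)
    have u1: "u (n + 1) = u (n + 2) + h * v (n + 1)"
      using rec[of "n + 1"] by (simp add: numeral_2_eq_2)
    have "(u (n + 2))\<^sup>2 - u (n + 1) * u (n + 3) = t\<^sup>2 * (h\<^sup>2 * (q\<^sup>2 - p * r))"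
      unfolding u1 u2 v1 ul by algebra
    moreover have "0 < t\<^sup>2 * (h\<^sup>2 * (q\<^sup>2 - p * r))"
      by (rule mult_pos_pos[OF _ pos]) (use t in simp)
    ultimately show ?thesis by linarith
  qed
  have last': "u (n + 2 - 1) * u (n + 2 + 1) < (u (n + 2))\<^sup>2"
    using last by (simp add: numeral_3_eq_3)
  \<comment> \<open>The end values are \<open>r\<close> and \<open>t * r\<close>, of opposite weak
    signs because \<open>t\<close> is negative.\<close>
  have ends: "(0 \<le> u 1 \<and> u (n + 2 + 1) \<le> 0) \<or> (u 1 \<le> 0 \<and> 0 \<le> u (n + 2 + 1))"
    using u1 ul t by (cases "0 \<le> r") (auto simp: mult_le_0_iff zero_le_mult_iff numeral_3_eq_3)
  have lc: "strictly_log_concave (n + 2) v"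
    using Suc.IH by (simp add: v_def)
  consider "positive_then_negative (n + 2) v" | "positive_then_negative (n + 2) (\<lambda>i. - v i)"
    using Suc.IH by (auto simp: v_def)
  then have "strictly_log_concave (n + 2 + 1) u \<and>
    (positive_then_negative (n + 2 + 1) u \<or> positive_then_negative (n + 2 + 1) (\<lambda>i. - u i))"
  proof cases
    case 1
    show ?thesis
      by (rule strictly_log_concave_step[OF _ h rec ends lc 1 first last']) simp_all
  next
    case 2
    have rec': "- u (i + 1) = - u i - h * - v i" if "1 \<le> i" "i \<le> n + 2" for i
      using rec[OF that] by simp
    have ends': "(0 \<le> - u 1 \<and> - u (n + 2 + 1) \<le> 0) \<or> (- u 1 \<le> 0 \<and> 0 \<le> - u (n + 2 + 1))"
      using ends by linarith
    have lc': "strictly_log_concave (n + 2) (\<lambda>i. - v i)"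
      using lc by (simp add: strictly_log_concave_uminus)
    have first': "- u 1 * - u 3 < (- u 2)\<^sup>2" and last'': "- u (n + 2 - 1) * - u (n + 2 + 1) < (- u (n + 2))\<^sup>2"
      using first last' by simp_all
    have "strictly_log_concave (n + 2 + 1) (\<lambda>i. - u i) \<and>
      (positive_then_negative (n + 2 + 1) (\<lambda>i. - u i) \<or> positive_then_negative (n + 2 + 1) (\<lambda>i. - (- u i)))"
      by (rule strictly_log_concave_step[OF _ h rec' ends' lc' 2 first' last'']) simp_all
    then show ?thesis
      by (auto simp: strictly_log_concave_uminus)
  qed
  then show ?case
    by (simp add: u_def eval_nat_numeral)
qed

text \<open>Write S_r for the partial sums. Log-concavity carries the bound \<open>K\<close> on the
  last ratio back along the negative tail. As the total is 0, S_r is minus the sum of the later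
  terms, so S_r is at least \<open>- w (r + 1)\<close>. Hence \<open>- w r\<close> is at most K S_r
  and S_{r-1} is at most (1 + K) S_r. Where \<open>w r\<close> is nonnegative,
  \<open>c \<le> 1\<close> suffices.\<close>

lemma partial_sums_ratio:
  fixes w :: "nat \<Rightarrow> real"
  assumes D: "2 \<le> D" and lc: "strictly_log_concave D w" and pn: "positive_then_negative D w"
    and total: "sum w {1..D} = 0" and last: "w D < 0"
    and K: "0 \<le> K" "- w (D - 1) \<le> K * - w D"
    and c: "0 \<le> c" "c * (1 + K) \<le> 1"
  shows "r \<le> D \<Longrightarrow> 0 \<le> sum w {1..r}"
    and "1 \<le> r \<Longrightarrow> r < D \<Longrightarrow> c * sum w {1..r - 1} \<le> sum w {1..r}"
proof -
  have tail: "sum w {1..r} = (\<Sum>j=r + 1..D. - w j)" if "r \<le> D" for r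
  proof -
    have "sum w {1..D} = sum w {1..r} + sum w {r + 1..D}"
      by (rule sum.ub_add_nat[of 1 r w "D - r", simplified that le_add_diff_inverse]) simp
    then show ?thesis using total by (simp add: sum_negf)
  qed
  obtain k where k: "k \<le> D" "\<And>i. 1 \<le> i \<Longrightarrow> i \<le> k \<Longrightarrow> 0 \<le> w i" "\<And>i. k < i \<Longrightarrow> i \<le> D \<Longrightarrow> w i \<le> 0"
    using positive_then_negative_split[OF pn] by blast
  have nonneg: "0 \<le> sum w {1..r}" if "r \<le> D" for r
  proof (cases "r \<le> k")
    case True
    then show ?thesis by (intro sum_nonneg k(2)) auto
  next
    case False
    then show ?thesis
      unfolding tail[OF that] by (intro sum_nonneg) (use k(3) in auto)
  qed
  then show "r \<le> D \<Longrightarrow> 0 \<le> sum w {1..r}" .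
  have ratio: "- w j \<le> K * - w (j + 1)" if "w j < 0" "1 \<le> j" "j \<le> D - 1" for j
    using that(3,1,2)
  proof (induction j rule: inc_induct)
    case base
    then show ?case using K D by simp
  next
    case (step j)
    have j: "1 \<le> j" "j + 2 \<le> D" "w j < 0" using step by auto
    have lcj: "w j * w (j + 2) < (w (j + 1))\<^sup>2"
      using lc j by (simp add: strictly_log_concave_def)
    have neg: "w (j + 1) \<le> 0" "w (j + 2) \<le> 0"
      using pn[unfolded positive_then_negative_def] j by auto
    then have "w (j + 1) \<noteq> 0"
      using lcj mult_nonpos_nonpos[of "w j" "w (j + 2)"] j by auto
    then have w1: "w (j + 1) < 0" using neg by simp
    have IH: "- w (j + 1) \<le> K * - w (j + 2)"
      using step.IH w1 by simp
    have w2: "w (j + 2) < 0"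
      using IH w1 neg by (cases "w (j + 2) = 0") auto
    have "w j * w (j + 2) < (- w (j + 1)) * (- w (j + 1))"
      using lcj by (simp add: power2_eq_square)
    also have "\<dots> \<le> (- w (j + 1)) * (K * - w (j + 2))"
      using IH w1 by (intro mult_left_mono) auto
    finally have "(- w j) * (- w (j + 2)) < (K * - w (j + 1)) * (- w (j + 2))"
      by (simp add: mult_ac)
    then show ?case using w2 by simp
  qed
  show "c * sum w {1..r - 1} \<le> sum w {1..r}" if r: "1 \<le> r" "r < D"
  proof -
    have split: "sum w {1..r} = sum w {1..r - 1} + w r"
      using r by (cases r) auto
    have Vn: "0 \<le> sum w {1..r - 1}" using nonneg r by simp
    have c1: "c \<le> 1"
      using c K(1) mult_left_mono[of 1 "1 + K" c] by simp
    show ?thesis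
    proof (cases "w r < 0")
      case False
      have "c * sum w {1..r - 1} \<le> 1 * sum w {1..r - 1}"
        using Vn c1 by (rule mult_right_mono[rotated])
      then show ?thesis using split False by simp
    next
      case True
      have neg: "w j \<le> 0" if "r < j" "j \<le> D" for j
        using pn True r that by (auto simp: positive_then_negative_def)
      have "- w (r + 1) = (\<Sum>j\<in>{r + 1}. - w j)" by simp
      also have "\<dots> \<le> (\<Sum>j=r + 1..D. - w j)"
        by (rule sum_mono2) (use r neg in auto)
      also have "\<dots> = sum w {1..r}"
        using tail[of r] r by simp
      finally have V: "- w (r + 1) \<le> sum w {1..r}" .
      have "- w r \<le> K * - w (r + 1)" using ratio True r by simp
      also have "\<dots> \<le> K * sum w {1..r}"
        using V K(1) by (rule mult_left_mono)
      finally have "sum w {1..r - 1} \<le> (1 + K) * sum w {1..r}"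
        using split by (simp add: algebra_simps)
      then have "c * sum w {1..r - 1} \<le> c * ((1 + K) * sum w {1..r})"
        using c(1) by (rule mult_left_mono)
      also have "\<dots> = c * (1 + K) * sum w {1..r}"
        by simp
      also have "\<dots> \<le> 1 * sum w {1..r}"
        using c(2) nonneg[of r] r by (intro mult_right_mono) auto
      finally show ?thesis by simp
    qed
  qed
qed

section \<open>Signs of the family at the zeros of A_1(d)\<close>

lemma refined_Eulerian_sum:
  assumes "i \<le> d"
  shows "poly (refined_Eulerian (d + 1) (i + 1)) t =
    poly (Eulerian_poly d) t - (1 - t) * (\<Sum>j=1..i. poly (refined_Eulerian d j) t)"
  using assms
proof (induction i)
  case (Suc i)
  then show ?case
    using poly_refined_Eulerian_Suc[of "i + 1" d t] by (simp add: algebra_simps)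
qed simp

lemma refined_Eulerian_signs_at_zero:
  fixes t c :: real
  assumes n: "1 \<le> n" and t: "t < 0" and zero: "poly (Eulerian_poly (n + 2)) t = 0"
    and c: "0 \<le> c" "c \<le> 2 - sqrt 3"
  defines "u \<equiv> \<lambda>i. poly (refined_Eulerian (n + 3) i) t"
    and "g \<equiv> t * poly (pderiv (Eulerian_poly (n + 2))) t"
  shows "1 \<le> i \<Longrightarrow> i \<le> n + 3 \<Longrightarrow> 0 \<le> u i * g"
    and "2 \<le> r \<Longrightarrow> r \<le> n + 1 \<Longrightarrow> 0 \<le> (u (r + 1) - c * u r) * g"
proof -
  define h where "h = 1 - t"
  define v where "v i = poly (refined_Eulerian (n + 2) i) t" for i
  define p q where "p = poly (Eulerian_poly n) t" and "q = poly (Eulerian_poly (n + 1)) t"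
  have h: "0 < h" using t by (simp add: h_def)
  have v1: "v 1 = q"
    by (simp add: v_def q_def eval_nat_numeral)
  have vl: "v (n + 2) = t * q"
    using poly_refined_Eulerian_last[of "n + 1" t] by (simp add: v_def q_def eval_nat_numeral)
  have vp: "v (n + 1) = t * q + h * (t * p)"
    using poly_refined_Eulerian_Suc[of "n + 1" "n + 1" t] vl poly_refined_Eulerian_last[of n t] n
    by (simp add: v_def p_def h_def eval_nat_numeral)
  have "0 < q\<^sup>2"
    using Eulerian_Turan[OF t, of n] zero by (simp add: q_def)
  then have "q \<noteq> 0" by simp
  have g: "poly (Eulerian_poly (n + 3)) t = h * g"
    using poly_Eulerian_poly_Suc[of "n + 2" t] zero by (simp add: g_def h_def eval_nat_numeral)
  \<comment> \<open>The Turan inequality centred at the vanishing B_{n+2}: its outer factors are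
    \<open>q\<close> and \<open>h * g\<close>.\<close>
  have "q * (h * g) < 0"
    using Eulerian_Turan[OF t, of "n + 1"] zero g by (simp add: q_def eval_nat_numeral)
  then have "h * (q * g) < 0"
    by (simp add: mult_ac)
  then have qg: "q * g < 0"
    using h by (simp add: mult_less_0_iff[of h])
  have u: "u (i + 1) = - (h * sum v {1..i})" if "i \<le> n + 2" for i
    using refined_Eulerian_sum[OF that, of t] zero by (simp add: u_def h_def v_def[abs_def] eval_nat_numeral)
  have "u (n + 2 + 1) = 0"
    using poly_refined_Eulerian_last[of "n + 2" t] zero by (simp add: u_def eval_nat_numeral)
  then have total: "sum v {1..n + 2} = 0"
    using u[of "n + 2"] h by simp
  \<comment> \<open>The sign \<open>s\<close> selects which of \<open>v\<close> and
    \<open>- v\<close> is positive first; the factor is undone at the end through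
    \<open>s\<^sup>2 = 1\<close>.\<close>
  obtain s :: real where s: "s\<^sup>2 = 1" and pn: "positive_then_negative (n + 2) (\<lambda>i. s * v i)"
  proof -
    have "positive_then_negative (n + 2) v \<or> positive_then_negative (n + 2) (\<lambda>i. - v i)"
      using refined_Eulerian_log_concave[OF t, of n] by (simp add: v_def[abs_def])
    then show ?thesis
      using that[of 1] that[of "- 1"] by auto
  qed
  define w where "w i = s * v i" for i
  have lc: "strictly_log_concave (n + 2) w"
  proof -
    have "strictly_log_concave (n + 2) v"
      using refined_Eulerian_log_concave[OF t, of n] by (simp add: v_def[abs_def])
    moreover have "w i * w j = s\<^sup>2 * (v i * v j)" for i j
      by (simp add: w_def power2_eq_square)
    ultimately show ?thesis
      unfolding strictly_log_concave_def power2_eq_square[of "w _"] power2_eq_square[of "v _"]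
      by (simp add: s)
  qed
  have pn: "positive_then_negative (n + 2) w"
    using pn by (simp add: w_def[abs_def])
  have "s \<noteq> 0" using s by auto
  \<comment> \<open>The first entry \<open>s * q\<close> and the last entry
    \<open>t * (s * q)\<close> have opposite signs, so the pattern of \<open>w\<close> decides the
    sign of \<open>s * q\<close>.\<close>
  have sq: "0 < s * q"
  proof (rule ccontr)
    assume "\<not> 0 < s * q"
    then have neg: "s * q < 0"
      using \<open>q \<noteq> 0\<close> \<open>s \<noteq> 0\<close> by (simp add: not_less le_less)
    then have "w 1 < 0" unfolding w_def v1 .
    then have "w (n + 2) \<le> 0"
      using pn[unfolded positive_then_negative_def, rule_format, of 1 "n + 2"] by simp
    then have "t * (s * q) \<le> 0"
      unfolding w_def vl by (simp add: mult_ac)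
    then show False
      using mult_neg_neg[OF t neg] by simp
  qed
  have sg: "s * g \<le> 0"
  proof -
    have "(s * q) * (s * g) = s\<^sup>2 * (q * g)" by (simp add: power2_eq_square)
    then have "(s * q) * (s * g) < 0" unfolding s using qg by linarith
    then show ?thesis using sq mult_pos_pos[of "s * q" "s * g"] by linarith
  qed
  have wD: "w (n + 2) < 0"
    using mult_neg_pos[OF t sq] unfolding w_def vl by (simp add: mult_ac)
  have "\<bar>h * p\<bar> \<le> sqrt 3 * \<bar>q\<bar>"
  proof (rule power2_le_imp_le)
    have "(h * p)\<^sup>2 \<le> 3 * q\<^sup>2"
      using Eulerian_ratio_at_zero[OF t n zero] by (simp add: h_def p_def q_def)
    then show "\<bar>h * p\<bar>\<^sup>2 \<le> (sqrt 3 * \<bar>q\<bar>)\<^sup>2"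
      by (simp add: power_mult_distrib)
  qed simp
  moreover have "\<bar>s\<bar> = 1"
    using s by (simp add: power2_eq_1_iff) linarith
  ultimately have hp: "s * (h * p) \<le> sqrt 3 * (s * q)"
    using sq abs_mult[of s q] abs_mult[of s "h * p"] abs_ge_self[of "s * (h * p)"] by simp
  \<comment> \<open>The ratio of the last two terms is \<open>1 + h * p / q\<close>, which gives
    \<open>K = 1 + sqrt 3\<close>.\<close>
  have Kw: "- w (n + 2 - 1) \<le> (1 + sqrt 3) * - w (n + 2)"
  proof -
    have "- t * (s * (h * p)) \<le> - t * (sqrt 3 * (s * q))"
      using hp t by (intro mult_left_mono) auto
    moreover have "w (n + 2 - 1) = t * (s * q) + t * (s * (h * p))"
      using vp by (simp add: w_def algebra_simps)
    moreover have "w (n + 2) = t * (s * q)"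
      unfolding w_def vl by (simp add: mult_ac)
    ultimately show ?thesis
      by (simp only:) (simp add: algebra_simps)
  qed
  \<comment> \<open>\<open>1 + K = 2 + sqrt 3\<close> is the reciprocal of
    \<open>2 - sqrt 3\<close>; this is the source of the threshold.\<close>
  have cK: "c * (1 + (1 + sqrt 3)) \<le> 1"
  proof -
    have "c * (2 + sqrt 3) \<le> (2 - sqrt 3) * (2 + sqrt 3)"
      using c(2) by (intro mult_right_mono) auto
    also have "\<dots> = 1" by (simp add: algebra_simps)
    finally show ?thesis by simp
  qed
  have totalw: "sum w {1..n + 2} = 0"
    using total by (simp add: w_def sum_distrib_left[symmetric])
  have V: "u (i + 1) * g = - h * (s * g) * sum w {1..i}" if "i \<le> n + 2" for i
  proof -
    have "sum w {1..i} = s * sum v {1..i}" by (simp add: w_def sum_distrib_left)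
    then have "- h * (s * g) * sum w {1..i} = s\<^sup>2 * (- h * sum v {1..i} * g)"
      by (simp add: power2_eq_square)
    then show ?thesis unfolding u[OF that] s by (simp only: mult_1 mult_minus_left mult.assoc)
  qed
  note ps = partial_sums_ratio[OF _ lc pn totalw wD _ Kw c(1) cK, simplified]
  have hsg: "0 \<le> - h * (s * g)"
    using h sg by (simp add: mult_nonneg_nonpos)
  show "0 \<le> u i * g" if i: "1 \<le> i" "i \<le> n + 3"
  proof -
    have "0 \<le> - h * (s * g) * sum w {1..i - 1}"
      by (rule mult_nonneg_nonneg[OF hsg]) (use ps(1)[of "i - 1"] i in simp)
    then show ?thesis
      using V[of "i - 1"] i by simp
  qed
  show "0 \<le> (u (r + 1) - c * u r) * g" if r: "2 \<le> r" "r \<le> n + 1"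
  proof -
    have "0 \<le> - h * (s * g) * (sum w {1..r} - c * sum w {1..r - 1})"
      by (rule mult_nonneg_nonneg[OF hsg]) (use ps(2)[of r] r in simp)
    also have "\<dots> = u (r + 1) * g - c * (u r * g)"
      using V[of r] V[of "r - 1"] r by (simp add: algebra_simps)
    finally show ?thesis by (simp add: algebra_simps)
  qed
qed


section \<open>Compatibility\<close>

lemma refined_Eulerian_at_0:
  assumes "2 \<le> i" "i \<le> d"
  shows "poly (refined_Eulerian d i) 0 = 0"
proof -
  obtain j e where j: "i = j + 1" "d = e + 1" "1 \<le> j" "j \<le> e"
    using assms by (cases i; cases d) auto
  then show ?thesis
    by (simp add: refined_Eulerian_pderiv[of j e, simplified])
qed

text \<open>For fixed nodes the sign criterion is a system of linear inequalities, so it passes from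
  the members to all nonnegative combinations.\<close>

lemma compatible_Eulerian_family:
  assumes d: "4 \<le> d" and c: "0 \<le> c" "c \<le> 2 - sqrt 3"
  shows "compatible (Eulerian_family d c)"
proof -
  define n where "n = d - 3"
  have n: "1 \<le> n" "d = n + 3" using d by (auto simp: n_def)
  define R where "R = Eulerian_zeros (n + 2)"
  \<comment> \<open>As \<open>d = n + 3\<close>, these are the \<open>d - 1\<close> zeros of t
    A_1(d), as many as the degree bound of the members.\<close>
  define G where "G = insert 0 R"
  have R: "finite R" "\<And>r. r \<in> R \<Longrightarrow> r < 0"
    using finite_Eulerian_zeros Eulerian_zeros_neg by (auto simp: R_def)
  then have "0 \<notin> R" by blast
  have cardG: "card G = n + 2"
    using R \<open>0 \<notin> R\<close> card_Eulerian_zeros[of "n + 1"] by (simp add: G_def R_def)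
  have finF: "finite (Eulerian_family d c)"
    by (simp add: Eulerian_family_def)
  have fam: "degree p \<le> card G \<and> (\<forall>x\<in>G. 0 \<le> poly p x * (\<Prod>y\<in>G - {x}. x - y))"
    if "p \<in> Eulerian_family d c" for p
  proof
    have degA: "degree (refined_Eulerian d i) \<le> n + 2" for i
      using degree_refined_Eulerian_le[of d i] n by simp
    show "degree p \<le> card G"
      using that unfolding Eulerian_family_def E_poly_def cardG
      by (auto intro!: degA[simplified] degree_diff_le order_trans[OF degree_smult_le])
    show "\<forall>x\<in>G. 0 \<le> poly p x * (\<Prod>y\<in>G - {x}. x - y)"
    proof
      fix x assume "x \<in> G"
      then consider "x = 0" | "x \<in> R" "x < 0" using R(2) by (auto simp: G_def)
      then show "0 \<le> poly p x * (\<Prod>y\<in>G - {x}. x - y)"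
      proof cases
        case 1
        have "0 \<le> (\<Prod>y\<in>G - {0}. 0 - y)"
          by (rule prod_nonneg) (use R(2) in \<open>force simp: G_def\<close>)
        moreover have "0 \<le> poly p 0"
        proof -
          have "0 \<le> poly (refined_Eulerian d i) 0" if "1 \<le> i" "i \<le> d" for i
          proof (cases "i = 1")
            case True
            then show ?thesis
              using Eulerian_poly_pos[of 0 "n + 2"] n by (simp add: numeral_3_eq_3)
          next
            case False
            then show ?thesis using refined_Eulerian_at_0[of i d] that by simp
          qed
          moreover have "poly (E_poly d c r) 0 = 0" if "2 \<le> r" "r \<le> d - 2" for r
            using refined_Eulerian_at_0[of r d] refined_Eulerian_at_0[of "r + 1" d] that d
            by (simp add: E_poly_def)
          ultimately show ?thesis
            using \<open>p \<in> Eulerian_family d c\<close> by (auto simp: Eulerian_family_def)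
        qed
        ultimately show ?thesis using 1 by simp
      next
        case 2
        have zero: "poly (Eulerian_poly (n + 2)) x = 0"
          using 2 by (simp add: R_def Eulerian_zeros_def)
        have "G - {x} = insert 0 (R - {x})"
          using 2 by (auto simp: G_def)
        then have g: "(\<Prod>y\<in>G - {x}. x - y) = x * poly (pderiv (Eulerian_poly (n + 2))) x"
          unfolding Eulerian_poly_simple_zero(1)[OF zero] R_def[symmetric]
          using R(1) \<open>0 \<notin> R\<close> by simp
        note signs = refined_Eulerian_signs_at_zero[OF n(1) 2(2) zero c, folded n(2)]
        from that consider i where "p = refined_Eulerian d i" "1 \<le> i" "i \<le> d"
          | r where "p = E_poly d c r" "2 \<le> r" "r \<le> d - 2"
          by (auto simp: Eulerian_family_def)
        then show ?thesis
        proof cases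
          case 1
          then show ?thesis using signs(1) unfolding g by simp
        next
          case 2
          then show ?thesis using signs(2)[of r] n unfolding g E_poly_def by simp
        qed
      qed
    qed
  qed
  show ?thesis
    unfolding compatible_def
  proof (intro conjI allI impI)
    fix w :: "real poly \<Rightarrow> real"
    assume w: "\<forall>p\<in>Eulerian_family d c. 0 \<le> w p"
      and nz: "(\<Sum>p\<in>Eulerian_family d c. smult (w p) p) \<noteq> 0"
    show "only_real_zeros (\<Sum>p\<in>Eulerian_family d c. smult (w p) p)"
    proof (rule only_real_zeros_of_signs[OF _ _ _ nz])
      show "finite G" using R by (simp add: G_def)
      show "degree (\<Sum>p\<in>Eulerian_family d c. smult (w p) p) \<le> card G"
        by (rule degree_sum_le[OF finF]) (use fam degree_smult_le order_trans in blast)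
      fix x assume x: "x \<in> G"
      have "poly (\<Sum>p\<in>Eulerian_family d c. smult (w p) p) x * (\<Prod>y\<in>G - {x}. x - y)
          = (\<Sum>p\<in>Eulerian_family d c. w p * (poly p x * (\<Prod>y\<in>G - {x}. x - y)))"
        by (simp add: poly_sum sum_distrib_right mult.assoc)
      also have "\<dots> \<ge> 0"
      proof (rule sum_nonneg)
        fix p assume "p \<in> Eulerian_family d c"
        with w fam x show "0 \<le> w p * (poly p x * (\<Prod>y\<in>G - {x}. x - y))"
          by (intro mult_nonneg_nonneg[of "w p"]) blast+
      qed
      finally show "0 \<le> poly (\<Sum>p\<in>Eulerian_family d c. smult (w p) p) x * (\<Prod>y\<in>G - {x}. x - y)" .
    qed
  qed (rule finF)
qed

section \<open>Optimality of the constant from d = 4\<close>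

lemma refined_Eulerian_4:
  "refined_Eulerian 4 1 = [:1, 4, 1:]" "refined_Eulerian 4 2 = [:0, 4, 2:]" "refined_Eulerian 4 3 = [:0, 2, 4:]"
proof -
  have 1: "refined_Eulerian 2 1 = 1"
    using Eulerian_poly_Suc[of 0] Eulerian_poly_0 by (simp add: numeral_2_eq_2)
  have 2: "refined_Eulerian 3 1 = [:1, 1:]"
    using Eulerian_poly_Suc[of 1] 1 by (simp add: numeral_2_eq_2 numeral_3_eq_3 one_pCons)
  have 3: "refined_Eulerian 4 1 = [:1, 4, 1:]"
    using Eulerian_poly_Suc[of 2] 2 by (simp add: eval_nat_numeral one_pCons pderiv_pCons of_nat_poly)
  have 4: "refined_Eulerian 3 2 = [:0, 2:]"
    using refined_Eulerian_Suc[of 1 2] 1 2 by (simp add: eval_nat_numeral one_pCons)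
  have 5: "refined_Eulerian 4 2 = [:0, 4, 2:]"
    using refined_Eulerian_Suc[of 1 3] 2 3 by (simp add: eval_nat_numeral one_pCons)
  have 6: "refined_Eulerian 4 3 = [:0, 2, 4:]"
    using refined_Eulerian_Suc[of 2 3] 4 5 by (simp add: eval_nat_numeral one_pCons)
  show "refined_Eulerian 4 1 = [:1, 4, 1:]" "refined_Eulerian 4 2 = [:0, 4, 2:]" "refined_Eulerian 4 3 = [:0, 2, 4:]"
    by (fact 3 5 6)+
qed

lemma quadratic_not_only_real_zeros:
  assumes "b\<^sup>2 < 4 * a"
  shows "\<not> only_real_zeros [:1, b, a:]"
proof
  assume real: "only_real_zeros [:1, b, a:]"
  have a: "0 < a" using assms zero_le_power2[of b] by linarith
  then obtain z where z: "poly (map_poly complex_of_real [:1, b, a:]) z = 0"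
    using complex_root_exists[of "[:1, b, a:]"] by auto
  then obtain x where x: "z = of_real x"
    using real by (auto simp: only_real_zeros_def elim: Reals_cases)
  have "1 + x * (b + x * a) = 0"
    using z unfolding x poly_map_poly_of_real of_real_eq_0_iff by simp
  then have "(2 * a * x + b)\<^sup>2 = b\<^sup>2 - 4 * a"
    by algebra
  then show False
    using assms zero_le_power2[of "2 * a * x + b"] by linarith
qed

text \<open>The weight adds three separate contributions, so \<open>p\<close>, \<open>q\<close> and
  \<open>r\<close> are allowed to coincide.\<close>

lemma compatible_add:
  assumes "compatible F" "p \<in> F" "q \<in> F" "r \<in> F" "0 \<le> \<alpha>" "0 \<le> \<beta>" "0 \<le> \<gamma>"
    and "smult \<alpha> p + smult \<beta> q + smult \<gamma> r \<noteq> 0"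
  shows "only_real_zeros (smult \<alpha> p + smult \<beta> q + smult \<gamma> r)"
proof -
  define w where "w f = (if f = p then \<alpha> else 0) + (if f = q then \<beta> else 0) + (if f = r then \<gamma> else 0)" for f
  have "finite F" using assms by (simp add: compatible_def)
  have "(\<Sum>f\<in>F. smult (w f) f) =
      (\<Sum>f\<in>F. if p = f then smult \<alpha> f else 0) + (\<Sum>f\<in>F. if q = f then smult \<beta> f else 0)
      + (\<Sum>f\<in>F. if r = f then smult \<gamma> f else 0)"
    unfolding sum.distrib[symmetric] by (intro sum.cong refl) (auto simp: w_def smult_add_left)
  also have "\<dots> = smult \<alpha> p + smult \<beta> q + smult \<gamma> r"
    using assms \<open>finite F\<close> by simp
  finally have "(\<Sum>f\<in>F. smult (w f) f) = smult \<alpha> p + smult \<beta> q + smult \<gamma> r" .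
  moreover have "\<forall>f\<in>F. 0 \<le> w f"
    using assms by (simp add: w_def)
  ultimately show ?thesis
    using assms(1,8) unfolding compatible_def by metis
qed

lemma compatible_Eulerian_family_4_le:
  assumes "compatible (Eulerian_family 4 c)"
  shows "c \<le> 2 - sqrt 3"
proof (rule ccontr)
  assume "\<not> c \<le> 2 - sqrt 3"
  \<comment> \<open>Any number between \<open>2 - sqrt 3\<close> and \<open>1 / 2\<close> would do for \<open>2 / 5\<close>; \<open>\<mu>\<close> minimises the discriminant of
    \<open>A\<^sub>1 + \<mu> (A\<^sub>3 - e A\<^sub>2)\<close>, which is a nonnegative combination since \<open>e \<le> c\<close>.\<close>
  define e where "e = min c (2 / 5)"
  define \<mu> where "\<mu> = 12 * e / (2 - 4 * e)\<^sup>2"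
  define b a where "b = 4 + \<mu> * (2 - 4 * e)" and "a = 1 + \<mu> * (4 - 2 * e)"
  have "(8 / 5)\<^sup>2 < (3::real)" by (simp add: power2_eq_square)
  then have "8 / 5 < sqrt 3"
    by (rule real_less_rsqrt)
  then have e: "2 - sqrt 3 < e" "e \<le> c" "e \<le> 2 / 5"
    using \<open>\<not> c \<le> 2 - sqrt 3\<close> by (auto simp: e_def)
  have "sqrt 3 < 2" by (rule real_less_lsqrt) auto
  then have e0: "0 < e" using e by linarith
  have "(2 - e)\<^sup>2 < (sqrt 3)\<^sup>2"
    using e by (intro power_strict_mono) auto
  then have quad: "e\<^sup>2 - 4 * e + 1 < 0"
    by (simp add: power2_eq_square algebra_simps)
  have k: "0 < (2 - 4 * e)\<^sup>2" using e by simp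
  then have lam: "0 < \<mu>" and lamk: "\<mu> * (2 - 4 * e)\<^sup>2 = 12 * e"
    using e0 by (simp_all add: \<mu>_def)
  \<comment> \<open>The difference of the two sides is four times
    \<open>e\<^sup>2 - 4 * e + 1\<close>, whose smaller zero is \<open>2 - sqrt 3\<close>.\<close>
  have "(2 - 4 * e)\<^sup>2 < 12 * e\<^sup>2"
    using quad by (simp add: power2_eq_square algebra_simps)
  then have "\<mu> * (2 - 4 * e)\<^sup>2 < \<mu> * (12 * e\<^sup>2)"
    using lam by (rule mult_strict_left_mono)
  then have "12 * e * 1 < 12 * e * (\<mu> * e)"
    unfolding lamk by (simp add: power2_eq_square mult_ac)
  then have "1 < \<mu> * e"
    using e0 by (simp only: mult_less_cancel_left_pos[of "12 * e"])
  then have "12 - 12 * (\<mu> * e) < 0" by simp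
  \<comment> \<open>By the choice of \<open>\<mu>\<close> the last term equals
    \<open>12 * (\<mu> * e)\<close>, so the discriminant is
    \<open>12 - 12 * (\<mu> * e)\<close>.\<close>
  moreover have "b\<^sup>2 - 4 * a = 12 - 24 * (\<mu> * e) + \<mu> * (\<mu> * (2 - 4 * e)\<^sup>2)"
    unfolding a_def b_def by algebra
  ultimately have disc: "b\<^sup>2 < 4 * a"
    unfolding lamk by (simp add: mult_ac)
  have "(2::nat) + 1 = 3" by simp
  then have E: "E_poly 4 c 2 = [:0, 2, 4:] - smult c [:0, 4, 2:]"
    unfolding E_poly_def by (simp only: refined_Eulerian_4)
  \<comment> \<open>The multiple of A_2 lowers the parameter \<open>c\<close> of the E polynomial to
    \<open>e\<close>.\<close>
  have combo: "smult 1 (refined_Eulerian 4 1) + smult \<mu> (E_poly 4 c 2) + smult (\<mu> * (c - e)) (refined_Eulerian 4 2)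
      = [:1, b, a:]"
    unfolding refined_Eulerian_4 E by (simp add: a_def b_def algebra_simps)
  have "only_real_zeros [:1, b, a:]"
    unfolding combo[symmetric]
  proof (rule compatible_add[OF assms])
    show "smult 1 (refined_Eulerian 4 1) + smult \<mu> (E_poly 4 c 2) + smult (\<mu> * (c - e)) (refined_Eulerian 4 2) \<noteq> 0"
      unfolding combo by simp
  qed (use lam e in \<open>auto simp: Eulerian_family_def\<close>)
  then show False
    using quadratic_not_only_real_zeros[OF disc] by simp
qed

theorem lemma6p1:
  shows "(\<forall>d::nat. \<forall>c::real. d \<ge> 4 \<longrightarrow> 0 \<le> c \<longrightarrow> c \<le> 2 - sqrt 3 \<longrightarrow>
            compatible (Eulerian_family d c))
       \<and> (2 - sqrt 3 \<in> {c::real. 0 \<le> c \<and> (\<forall>d\<ge>4. compatible (Eulerian_family d c))}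
          \<and> (\<forall>c \<in> {c::real. 0 \<le> c \<and> (\<forall>d\<ge>4. compatible (Eulerian_family d c))}.
                c \<le> 2 - sqrt 3))"
proof -
  have "sqrt 3 \<le> 2"
    by (rule real_le_lsqrt) auto
  then show ?thesis
    using compatible_Eulerian_family compatible_Eulerian_family_4_le by auto
qed

end
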